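(* Let $S$ be a profinite semiring. For any Boolean space $X$, the collection $\mathbf{M}(X,S)$ of all the $S$-valued measures on $X$ is the free profinite strongly continuous $S$-semimodule on $X$. That is, $\mathbf{M}(X,S)$ is a profinite strongly continuous $S$-semimodule and, with respect to the continuous map $\eta_X\colon X\to\mathbf{M}(X,S)$ sending $x$ to the measure $\mu_x$ given by $\mu_x(b)=1$ if $x\in b$ and $\mu_x(b)=0$ otherwise, the following holds: for every profinite strongly continuous $S$-semimodule $Y$ and every continuous function $f\colon X\to Y$ there exists a unique continuous homomorphism of $S$-semimodules $g\colon\mathbf{M}(X,S)\to Y$ such that $g\circ\eta_X=f$.
   Context: A Boolean space is a compact Hausdorff space admitting a basis of clopen sets. A semiring $S=(S,+,\cdot,0,1)$ consists of a commutative monoid $(S,+,0)$ and a monoid $(S,\cdot,1)$ such that $\cdot$ distributes over $+$ on both sides and $s\cdot 0=0=0\cdot s$. A semiring is profinite if it is the limit of an inverse system of finite discrete semirings and semiring homomorphisms (equivalently, it carries a Boolean topology making $+$ and $\cdot$ continuous). An $S$-semimodule is a commutative monoid $(M,+,0)$ with a scalar multiplication $\alpha\colon S\times M\to M$, $(s,m)\mapsto sm$, satisfying $s(m+n)=sm+sn$, $(s+t)m=sm+tm$, $(s\cdot t)m=s(tm)$, $1m=m$, $0m=0=s0$. An $S$-semimodule $M$ equipped with a topology making $+\colon M\times M\to M$ continuous is strongly continuous if the scalar multiplication $\alpha\colon S\times M\to M$ is jointly continuous (product topology on $S\times M$, where $S$ has its profinite topology). A strongly continuous $S$-semimodule is profinite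 if it is the inverse limit (of topological $S$-semimodules) of finite and discrete strongly continuous $S$-semimodules and $S$-semimodule homomorphisms. Let $B$ be the Boolean algebra of clopen subsets of $X$. An $S$-valued measure on $X$ is a function $\mu\colon B\to S$ with $\mu(\emptyset)=0$ and $\mu(a\cup b)=\mu(a)+\mu(b)$ whenever $a\cap b=\emptyset$. $\mathbf{M}(X,S)$ is the set of all such measures, with pointwise $S$-semimodule operations $(\mu_1+\mu_2)(b)=\mu_1(b)+\mu_2(b)$, $(s\cdot\mu)(b)=s\cdot\mu(b)$, and the subspace topology induced by the product topology on $S^B$. *)

theory Defs
  imports "HOL-Analysis.Analysis" "HOL-Algebra.Module"
begin

section \<open>Boolean spaces\<close>

definition Boolean_space :: "'x topology \<Rightarrow> bool" where
  "Boolean_space X \<longleftrightarrow> compact_space X \<and> Hausdorff_space X \<and>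
     (\<exists>\<B>. (\<forall>b\<in>\<B>. openin X b \<and> closedin X b) \<and> openin X = arbitrary union_of (\<lambda>b. b \<in> \<B>))"

definition clopens :: "'x topology \<Rightarrow> 'x set set" where
  "clopens X = {b. openin X b \<and> closedin X b}"

section \<open>Semirings and semimodules\<close>

text \<open>
  Semirings are those of HOL-Algebra: the locale \<^term>\<open>semiring\<close> requires neither commutativity of the
  multiplication nor that zero and one differ, and it includes the annihilation laws.  Membership in
  \<^term>\<open>ring_hom\<close> does not force preservation of zero in the absence of negatives.
\<close>

definition semiring_hom :: "('a, 'm) ring_scheme \<Rightarrow> ('b, 'n) ring_scheme \<Rightarrow> ('a \<Rightarrow> 'b) set" where
  "semiring_hom R S = {h \<in> ring_hom R S. h \<zero>\<^bsub>R\<^esub> = \<zero>\<^bsub>S\<^esub>}"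

text \<open>
  Semimodules reuse the record of HOL-Algebra for modules, whose fields for an internal multiplication
  and its unit are ignored.
\<close>

locale semimodule = R?: semiring R + M?: abelian_monoid M
  for R (structure) and M (structure) +
  assumes smult_closed:
      "\<lbrakk> s \<in> carrier R; x \<in> carrier M \<rbrakk> \<Longrightarrow> s \<odot>\<^bsub>M\<^esub> x \<in> carrier M"
    and smult_r_distr:
      "\<lbrakk> s \<in> carrier R; x \<in> carrier M; y \<in> carrier M \<rbrakk>
        \<Longrightarrow> s \<odot>\<^bsub>M\<^esub> (x \<oplus>\<^bsub>M\<^esub> y) = s \<odot>\<^bsub>M\<^esub> x \<oplus>\<^bsub>M\<^esub> s \<odot>\<^bsub>M\<^esub> y"
    and smult_l_distr:
      "\<lbrakk> s \<in> carrier R; t \<in> carrier R; x \<in> carrier M \<rbrakk>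
        \<Longrightarrow> (s \<oplus> t) \<odot>\<^bsub>M\<^esub> x = s \<odot>\<^bsub>M\<^esub> x \<oplus>\<^bsub>M\<^esub> t \<odot>\<^bsub>M\<^esub> x"
    and smult_assoc:
      "\<lbrakk> s \<in> carrier R; t \<in> carrier R; x \<in> carrier M \<rbrakk>
        \<Longrightarrow> (s \<otimes> t) \<odot>\<^bsub>M\<^esub> x = s \<odot>\<^bsub>M\<^esub> (t \<odot>\<^bsub>M\<^esub> x)"
    and smult_one: "x \<in> carrier M \<Longrightarrow> \<one> \<odot>\<^bsub>M\<^esub> x = x"
    and smult_l_null: "x \<in> carrier M \<Longrightarrow> \<zero> \<odot>\<^bsub>M\<^esub> x = \<zero>\<^bsub>M\<^esub>"
    and smult_r_null: "s \<in> carrier R \<Longrightarrow> s \<odot>\<^bsub>M\<^esub> \<zero>\<^bsub>M\<^esub> = \<zero>\<^bsub>M\<^esub>"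

definition semimodule_hom :: "'s ring \<Rightarrow> ('s, 'a) module \<Rightarrow> ('s, 'b) module \<Rightarrow> ('a \<Rightarrow> 'b) set" where
  "semimodule_hom S M N = {h \<in> carrier M \<rightarrow> carrier N.
     (\<forall>x\<in>carrier M. \<forall>y\<in>carrier M. h (x \<oplus>\<^bsub>M\<^esub> y) = h x \<oplus>\<^bsub>N\<^esub> h y) \<and>
     h \<zero>\<^bsub>M\<^esub> = \<zero>\<^bsub>N\<^esub> \<and>
     (\<forall>s\<in>carrier S. \<forall>x\<in>carrier M. h (s \<odot>\<^bsub>M\<^esub> x) = s \<odot>\<^bsub>N\<^esub> h x)}"

definition strongly_continuous_semimodule ::
  "'s ring \<Rightarrow> 's topology \<Rightarrow> ('s, 'a) module \<Rightarrow> 'a topology \<Rightarrow> bool" where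
  "strongly_continuous_semimodule S TS M TM \<longleftrightarrow>
     semimodule S M \<and> topspace TM = carrier M \<and>
     continuous_map (prod_topology TM TM) TM (\<lambda>(x, y). x \<oplus>\<^bsub>M\<^esub> y) \<and>
     continuous_map (prod_topology TS TM) TM (\<lambda>(s, x). s \<odot>\<^bsub>M\<^esub> x)"

section \<open>Inverse limits of finite discrete objects\<close>

definition directed_poset :: "'i set \<Rightarrow> 'i rel \<Rightarrow> bool" where
  "directed_poset I r \<longleftrightarrow> I \<noteq> {} \<and> partial_order_on I r \<and>
     (\<forall>i\<in>I. \<forall>j\<in>I. \<exists>k\<in>I. (i, k) \<in> r \<and> (j, k) \<in> r)"

text \<open>Here \<^term>\<open>(i, j) \<in> r\<close> means \<open>i \<le> j\<close>, and \<^term>\<open>\<phi> i j\<close> is the transition map from stage \<open>j\<close> to stage \<open>i\<close>.\<close>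

definition inverse_system :: "'i set \<Rightarrow> 'i rel \<Rightarrow> ('i \<Rightarrow> 'c set) \<Rightarrow> ('i \<Rightarrow> 'i \<Rightarrow> 'c \<Rightarrow> 'c) \<Rightarrow> bool" where
  "inverse_system I r A \<phi> \<longleftrightarrow> directed_poset I r \<and>
     (\<forall>i j. (i, j) \<in> r \<longrightarrow> \<phi> i j \<in> A j \<rightarrow> A i) \<and>
     (\<forall>i\<in>I. \<forall>x\<in>A i. \<phi> i i x = x) \<and>
     (\<forall>i j k. (i, j) \<in> r \<longrightarrow> (j, k) \<in> r \<longrightarrow> (\<forall>x\<in>A k. \<phi> i j (\<phi> j k x) = \<phi> i k x))"

definition threads :: "'i set \<Rightarrow> 'i rel \<Rightarrow> ('i \<Rightarrow> 'c set) \<Rightarrow> ('i \<Rightarrow> 'i \<Rightarrow> 'c \<Rightarrow> 'c) \<Rightarrow> ('i \<Rightarrow> 'c) set" where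
  "threads I r A \<phi> = {t \<in> \<Pi>\<^sub>E i\<in>I. A i. \<forall>i j. (i, j) \<in> r \<longrightarrow> \<phi> i j (t j) = t i}"

text \<open>
  The space \<open>T\<close> with projections \<open>p\<close> is the limit of the system of discrete sets \<open>A\<close>: the induced map
  into the product is a homeomorphism onto the subspace of threads.  When all \<open>p i\<close> are
  homomorphisms, it is also an isomorphism of algebras, the operations on threads being pointwise.
\<close>

definition limit_cone ::
  "'a topology \<Rightarrow> 'i set \<Rightarrow> 'i rel \<Rightarrow> ('i \<Rightarrow> 'c set) \<Rightarrow> ('i \<Rightarrow> 'i \<Rightarrow> 'c \<Rightarrow> 'c) \<Rightarrow> ('i \<Rightarrow> 'a \<Rightarrow> 'c) \<Rightarrow> bool" where
  "limit_cone T I r A \<phi> p \<longleftrightarrow>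
     homeomorphic_map T
       (subtopology (product_topology (\<lambda>i. discrete_topology (A i)) I) (threads I r A \<phi>))
       (\<lambda>x. \<lambda>i\<in>I. p i x)"

definition limit_of_finite_semirings ::
  "'s ring \<Rightarrow> 's topology \<Rightarrow> 'i set \<Rightarrow> 'i rel \<Rightarrow> ('i \<Rightarrow> 'c ring) \<Rightarrow>
   ('i \<Rightarrow> 'i \<Rightarrow> 'c \<Rightarrow> 'c) \<Rightarrow> ('i \<Rightarrow> 's \<Rightarrow> 'c) \<Rightarrow> bool" where
  "limit_of_finite_semirings S TS I r N \<phi> p \<longleftrightarrow>
     semiring S \<and> topspace TS = carrier S \<and>
     (\<forall>i\<in>I. semiring (N i) \<and> finite (carrier (N i))) \<and>
     inverse_system I r (\<lambda>i. carrier (N i)) \<phi> \<and>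
     (\<forall>i j. (i, j) \<in> r \<longrightarrow> \<phi> i j \<in> semiring_hom (N j) (N i)) \<and>
     (\<forall>i\<in>I. p i \<in> semiring_hom S (N i)) \<and>
     limit_cone TS I r (\<lambda>i. carrier (N i)) \<phi> p"

definition limit_of_finite_semimodules ::
  "'s ring \<Rightarrow> 's topology \<Rightarrow> ('s, 'a) module \<Rightarrow> 'a topology \<Rightarrow> 'i set \<Rightarrow> 'i rel \<Rightarrow> ('i \<Rightarrow> ('s, 'c) module) \<Rightarrow>
   ('i \<Rightarrow> 'i \<Rightarrow> 'c \<Rightarrow> 'c) \<Rightarrow> ('i \<Rightarrow> 'a \<Rightarrow> 'c) \<Rightarrow> bool" where
  "limit_of_finite_semimodules S TS M TM I r N \<phi> p \<longleftrightarrow>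
     (\<forall>i\<in>I. finite (carrier (N i)) \<and>
        strongly_continuous_semimodule S TS (N i) (discrete_topology (carrier (N i)))) \<and>
     inverse_system I r (\<lambda>i. carrier (N i)) \<phi> \<and>
     (\<forall>i j. (i, j) \<in> r \<longrightarrow> \<phi> i j \<in> semimodule_hom S (N j) (N i)) \<and>
     (\<forall>i\<in>I. p i \<in> semimodule_hom S M (N i)) \<and>
     limit_cone TM I r (\<lambda>i. carrier (N i)) \<phi> p"

text \<open>
  HOL cannot quantify existentially over the types of the indices and of the finite objects, so the next
  two definitions fix them: indices are relations on the limit, and finite objects live on sets of naturals.
  This loses nothing, since a limit can be reindexed by the kernels of its projections; the
  lemmas \<open>profinite_semiringI\<close> and \<open>profinite_semimoduleI\<close> below establish it for arbitrary types.
\<close>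

definition profinite_semiring :: "'s ring \<Rightarrow> 's topology \<Rightarrow> bool" where
  "profinite_semiring S TS \<longleftrightarrow>
     (\<exists>(I :: ('s \<times> 's) set set) r (N :: ('s \<times> 's) set \<Rightarrow> nat ring) \<phi> p.
        limit_of_finite_semirings S TS I r N \<phi> p)"

definition profinite_semimodule ::
  "'s ring \<Rightarrow> 's topology \<Rightarrow> ('s, 'a) module \<Rightarrow> 'a topology \<Rightarrow> bool" where
  "profinite_semimodule S TS M TM \<longleftrightarrow>
     strongly_continuous_semimodule S TS M TM \<and>
     (\<exists>(I :: ('a \<times> 'a) set set) r (N :: ('a \<times> 'a) set \<Rightarrow> ('s, nat) module) \<phi> p.
        limit_of_finite_semimodules S TS M TM I r N \<phi> p)"

section \<open>Measures\<close>

text \<open>Measures are \<^term>\<open>undefined\<close> outside the clopen sets, so that they are determined by their values there.\<close>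

definition measures_on :: "'x topology \<Rightarrow> 's ring \<Rightarrow> ('x set \<Rightarrow> 's) set" where
  "measures_on X S = {\<mu> \<in> clopens X \<rightarrow>\<^sub>E carrier S. \<mu> {} = \<zero>\<^bsub>S\<^esub> \<and>
     (\<forall>a\<in>clopens X. \<forall>b\<in>clopens X. a \<inter> b = {} \<longrightarrow> \<mu> (a \<union> b) = \<mu> a \<oplus>\<^bsub>S\<^esub> \<mu> b)}"

definition measure_semimodule :: "'x topology \<Rightarrow> 's ring \<Rightarrow> ('s, 'x set \<Rightarrow> 's) module" where
  "measure_semimodule X S =
     \<lparr>carrier = measures_on X S, mult = undefined, one = undefined,
      zero = (\<lambda>b\<in>clopens X. \<zero>\<^bsub>S\<^esub>),
      add = (\<lambda>\<mu> \<nu>. \<lambda>b\<in>clopens X. \<mu> b \<oplus>\<^bsub>S\<^esub> \<nu> b),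
      smult = (\<lambda>s \<mu>. \<lambda>b\<in>clopens X. s \<otimes>\<^bsub>S\<^esub> \<mu> b)\<rparr>"

definition measure_topology :: "'x topology \<Rightarrow> 's ring \<Rightarrow> 's topology \<Rightarrow> ('x set \<Rightarrow> 's) topology" where
  "measure_topology X S TS = subtopology (product_topology (\<lambda>b. TS) (clopens X)) (measures_on X S)"

definition dirac :: "'x topology \<Rightarrow> 's ring \<Rightarrow> 'x \<Rightarrow> 'x set \<Rightarrow> 's" where
  "dirac X S x = (\<lambda>b\<in>clopens X. if x \<in> b then \<one>\<^bsub>S\<^esub> else \<zero>\<^bsub>S\<^esub>)"

section \<open>Independence of the chosen types\<close>

lemma limit_coneD:
  assumes "limit_cone T I r A \<phi> p"
  shows "(\<lambda>x. \<lambda>i\<in>I. p i x) ` topspace T = threads I r A \<phi>"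
    and "x \<in> topspace T \<Longrightarrow> i \<in> I \<Longrightarrow> p i x \<in> A i"
    and "x \<in> topspace T \<Longrightarrow> i \<in> I \<Longrightarrow> j \<in> I \<Longrightarrow> (i, j) \<in> r \<Longrightarrow> \<phi> i j (p j x) = p i x"
proof -
  have "(\<lambda>x. \<lambda>i\<in>I. p i x) ` topspace T =
      topspace (subtopology (product_topology (\<lambda>i. discrete_topology (A i)) I) (threads I r A \<phi>))"
    using assms unfolding limit_cone_def by (metis homeomorphic_imp_surjective_map)
  also have "\<dots> = threads I r A \<phi>"
    by (auto simp: threads_def)
  finally show *: "(\<lambda>x. \<lambda>i\<in>I. p i x) ` topspace T = threads I r A \<phi>" .
  {
    assume x: "x \<in> topspace T" and i: "i \<in> I"
    then have t: "(\<lambda>i\<in>I. p i x) \<in> threads I r A \<phi>" using * by blast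
    then show "p i x \<in> A i" using i by (auto simp: threads_def PiE_iff)
    assume j: "j \<in> I" and ij: "(i, j) \<in> r"
    have "\<phi> i j ((\<lambda>i\<in>I. p i x) j) = (\<lambda>i\<in>I. p i x) i"
      using t ij unfolding threads_def by blast
    then show "\<phi> i j (p j x) = p i x" using i j by simp
  }
qed

lemma continuous_map_product_discrete:
  assumes "\<And>k. k \<in> J \<Longrightarrow> s k \<in> I \<and> g k \<in> A (s k) \<rightarrow> B k"
    and "Y \<subseteq> (\<Pi>\<^sub>E i\<in>I. A i)" and "(\<lambda>t. \<lambda>k\<in>J. g k (t (s k))) ` Y \<subseteq> Z"
  shows "continuous_map (subtopology (product_topology (\<lambda>i. discrete_topology (A i)) I) Y)
           (subtopology (product_topology (\<lambda>k. discrete_topology (B k)) J) Z)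
           (\<lambda>t. \<lambda>k\<in>J. g k (t (s k)))"
proof -
  have "continuous_map (product_topology (\<lambda>i. discrete_topology (A i)) I)
           (discrete_topology (B k)) (\<lambda>t. g k (t (s k)))" if k: "k \<in> J" for k
  proof -
    have "continuous_map (product_topology (\<lambda>i. discrete_topology (A i)) I)
            (discrete_topology (A (s k))) (\<lambda>t. t (s k))"
      using assms(1)[OF k] continuous_map_product_projection[of "s k" I "\<lambda>i. discrete_topology (A i)"]
      by simp
    moreover have "continuous_map (discrete_topology (A (s k))) (discrete_topology (B k)) (g k)"
      using assms(1)[OF k] by auto
    ultimately show ?thesis
      by (rule continuous_map_compose[unfolded o_def])
  qed
  then have "continuous_map (product_topology (\<lambda>i. discrete_topology (A i)) I)
      (product_topology (\<lambda>k. discrete_topology (B k)) J) (\<lambda>t. \<lambda>k\<in>J. g k (t (s k)))"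
    by (auto simp: continuous_map_componentwise)
  then show ?thesis
    using assms(2,3)
    by (auto simp: continuous_map_in_subtopology continuous_map_from_subtopology)
qed

lemma limit_cone_reindex:
  fixes T :: "'a topology" and A :: "'i \<Rightarrow> 'c set"
  assumes sys: "inverse_system I r A \<phi>" and lim: "limit_cone T I r A \<phi> p"
    and fin: "\<And>i. i \<in> I \<Longrightarrow> finite (A i)" and nonempty: "\<exists>x. x \<in> topspace T"
  obtains I' :: "('a \<times> 'a) set set" and r' \<phi>' and q :: "('a \<times> 'a) set \<Rightarrow> 'a \<Rightarrow> nat"
  where "inverse_system I' r' (\<lambda>k. q k ` topspace T) \<phi>'"
    and "limit_cone T I' r' (\<lambda>k. q k ` topspace T) \<phi>' q"
    and "\<And>k l x. (k, l) \<in> r' \<Longrightarrow> x \<in> topspace T \<Longrightarrow> \<phi>' k l (q l x) = q k x"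
    and "\<And>k l. (k, l) \<in> r' \<Longrightarrow> k \<in> I' \<and> l \<in> I'"
    and "\<And>k. k \<in> I' \<Longrightarrow> finite (q k ` topspace T)"
    and "\<And>k. k \<in> I' \<Longrightarrow> \<exists>i\<in>I. \<exists>e. inj_on e (A i) \<and> q k = e \<circ> p i"
proof -
  let ?L = "topspace T"
  define K where "K i = {(x, y). x \<in> ?L \<and> y \<in> ?L \<and> p i x = p i y}" for i
  define I' where "I' = K ` I"
  define r' where "r' = {(k, l). k \<in> I' \<and> l \<in> I' \<and> l \<subseteq> k}"
  have "\<forall>k\<in>I'. \<exists>i. i \<in> I \<and> K i = k" by (auto simp: I'_def)
  then obtain sel where sel: "\<And>k. k \<in> I' \<Longrightarrow> sel k \<in> I \<and> K (sel k) = k" by metis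
  have "\<forall>i\<in>I. \<exists>e :: 'c \<Rightarrow> nat. inj_on e (A i)"
    using fin finite_imp_inj_to_nat_seg by metis
  then obtain e :: "'i \<Rightarrow> 'c \<Rightarrow> nat" where e: "\<And>i. i \<in> I \<Longrightarrow> inj_on (e i) (A i)" by metis
  define q where "q k = e (sel k) \<circ> p (sel k)" for k
  define pick where "pick l y = (SOME x. x \<in> ?L \<and> q l x = y)" for l y
  define \<phi>' where "\<phi>' k l y = q k (pick l y)" for k l y
  define d where "d i y = p i (pick (K i) y)" for i y
  have dir: "directed_poset I r" using sys by (simp add: inverse_system_def)
  have rI: "i \<in> I \<and> j \<in> I" if "(i, j) \<in> r" for i j
    using dir that by (auto simp: directed_poset_def order_on_defs refl_on_def)
  note pA = limit_coneD(2)[OF lim] and pc = limit_coneD(3)[OF lim]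
  have K_mono: "K j \<subseteq> K i" if "(i, j) \<in> r" for i j
    using that pc rI[OF that] unfolding K_def by clarsimp metis
  have pick: "pick l (q l x) \<in> ?L \<and> q l (pick l (q l x)) = q l x" if "x \<in> ?L" for l x
    unfolding pick_def by (rule someI[of _ x]) (use that in simp)
  have q_ker: "q k x = q k y \<longleftrightarrow> (x, y) \<in> k" if "k \<in> I'" "x \<in> ?L" "y \<in> ?L" for k x y
  proof -
    have "q k x = q k y \<longleftrightarrow> p (sel k) x = p (sel k) y"
      unfolding q_def o_def
      using e[of "sel k"] sel[of k] pA[of _ "sel k"] that by (metis inj_on_eq_iff)
    also have "\<dots> \<longleftrightarrow> (x, y) \<in> K (sel k)" using that by (simp add: K_def)
    finally show ?thesis using sel that by simp
  qed
  have \<phi>': "\<phi>' k l (q l x) = q k x" if "(k, l) \<in> r'" "x \<in> ?L" for k l x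
  proof -
    have kl: "k \<in> I'" "l \<in> I'" "l \<subseteq> k" using that by (auto simp: r'_def)
    have "(pick l (q l x), x) \<in> l" using pick[OF that(2)] q_ker kl that(2) by blast
    then show ?thesis unfolding \<phi>'_def using q_ker kl pick that(2) by blast
  qed
  have d: "d i (q (K i) x) = p i x" if "i \<in> I" "x \<in> ?L" for i x
  proof -
    have "K i \<in> I'" using that by (simp add: I'_def)
    then have "(pick (K i) (q (K i) x), x) \<in> K i" using pick that q_ker by blast
    then show ?thesis by (simp add: d_def K_def)
  qed
  let ?A' = "\<lambda>k. q k ` ?L"
  have sys': "inverse_system I' r' ?A' \<phi>'"
    unfolding inverse_system_def
  proof (intro conjI allI impI ballI)
    have "\<exists>k\<in>I'. (K i, k) \<in> r' \<and> (K j, k) \<in> r'" if ij: "i \<in> I" "j \<in> I" for i j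
    proof -
      obtain m where "m \<in> I" "(i, m) \<in> r" "(j, m) \<in> r"
        using dir ij unfolding directed_poset_def by meson
      then show ?thesis using K_mono ij by (intro bexI[of _ "K m"]) (auto simp: r'_def I'_def)
    qed
    moreover have "partial_order_on I' r'"
      by (auto simp: order_on_defs refl_on_def trans_def antisym_def r'_def)
    moreover have "I' \<noteq> {}" using dir by (auto simp: I'_def directed_poset_def)
    ultimately show "directed_poset I' r'"
      unfolding directed_poset_def I'_def by blast
    show "\<phi>' i j \<in> q j ` ?L \<rightarrow> q i ` ?L" if "(i, j) \<in> r'" for i j using \<phi>'[OF that] by auto
    show "\<phi>' i i x = x" if "i \<in> I'" "x \<in> q i ` ?L" for i x using \<phi>'[of i i] that by (auto simp: r'_def)
    show "\<phi>' i j (\<phi>' j k x) = \<phi>' i k x" if "(i, j) \<in> r'" "(j, k) \<in> r'" "x \<in> q k ` ?L" for i j k x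
    proof -
      have "(i, k) \<in> r'" using that by (auto simp: r'_def)
      then show ?thesis using \<phi>' that by auto
    qed
  qed
  let ?F = "\<lambda>x. \<lambda>i\<in>I. p i x" and ?F' = "\<lambda>x. \<lambda>k\<in>I'. q k x"
  let ?Th = "threads I r A \<phi>" and ?Th' = "threads I' r' ?A' \<phi>'"
  let ?Y = "subtopology (product_topology (\<lambda>i. discrete_topology (A i)) I) ?Th"
  let ?Y' = "subtopology (product_topology (\<lambda>k. discrete_topology (?A' k)) I') ?Th'"
  define h where "h = (\<lambda>t. \<lambda>k\<in>I'. e (sel k) (if t (sel k) \<in> p (sel k) ` ?L then t (sel k) else p (sel k) (SOME x. x \<in> ?L)))"
  define h' where "h' = (\<lambda>t. \<lambda>i\<in>I. d i (t (K i)))"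
  have Th: "?Th = ?F ` ?L" using limit_coneD(1)[OF lim] by simp
  have hF: "h (?F x) = ?F' x" if "x \<in> ?L" for x
    using sel that by (auto simp: h_def q_def fun_eq_iff)
  have F'Th: "?F' x \<in> ?Th'" if "x \<in> ?L" for x
    using \<phi>' that by (auto simp: threads_def r'_def)
  have h'F': "h' (?F' x) = ?F x" if "x \<in> ?L" for x
    using d that by (auto simp: h'_def fun_eq_iff I'_def)
  have h'Th: "h' t \<in> ?Th" if t: "t \<in> ?Th'" for t
  proof -
    have val: "t k \<in> q k ` ?L" if "k \<in> I'" for k using t that by (auto simp: threads_def PiE_iff)
    have comp: "\<phi>' k l (t l) = t k" if "(k, l) \<in> r'" for k l using t that by (auto simp: threads_def)
    have KI: "K i \<in> I'" if "i \<in> I" for i using that by (simp add: I'_def)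
    have "h' t \<in> (\<Pi>\<^sub>E i\<in>I. A i)"
    proof (rule PiE_I)
      fix i assume i: "i \<in> I"
      then obtain x where "x \<in> ?L" "t (K i) = q (K i) x" using val KI by blast
      then show "h' t i \<in> A i" using i d pA by (simp add: h'_def)
    qed (simp add: h'_def)
    moreover have "\<phi> i j (h' t j) = h' t i" if ij: "(i, j) \<in> r" for i j
    proof -
      have I: "i \<in> I" "j \<in> I" using rI ij by auto
      obtain x where x: "x \<in> ?L" "t (K j) = q (K j) x" using val KI I by blast
      have "(K i, K j) \<in> r'" using KI I K_mono[OF ij] by (simp add: r'_def)
      then have "t (K i) = q (K i) x" using comp \<phi>' x by metis
      then show ?thesis using I d x pc ij by (simp add: h'_def)
    qed
    ultimately show ?thesis by (simp add: threads_def)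
  qed
  have hh': "h (h' t) = t" if t: "t \<in> ?Th'" for t
  proof
    fix k
    show "h (h' t) k = t k"
    proof (cases "k \<in> I'")
      case True
      then obtain x where "x \<in> ?L" "t k = q k x" using t by (auto simp: threads_def PiE_iff)
      then show ?thesis using True sel[OF True] d[of "sel k" x] by (simp add: h_def h'_def q_def)
    next
      case False
      then show ?thesis using t by (auto simp: h_def threads_def PiE_iff extensional_def)
    qed
  qed
  have L: "limit_cone T I' r' ?A' \<phi>' q"
  proof -
    note ne = someI_ex[OF nonempty]
    have "continuous_map ?Y ?Y' h"
      unfolding h_def
      apply (rule continuous_map_product_discrete[where s = sel and g = "\<lambda>k y. e (sel k) (if y \<in> p (sel k) ` ?L then y else p (sel k) (SOME x. x \<in> ?L))"])
      subgoal using sel ne by (auto simp: q_def)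
      subgoal by (auto simp: threads_def)
      subgoal using hF F'Th unfolding h_def Th by auto
      done
    moreover have "continuous_map ?Y' ?Y h'"
      unfolding h'_def
      apply (rule continuous_map_product_discrete)
      subgoal using d pA by (auto simp: I'_def)
      subgoal by (auto simp: threads_def)
      subgoal using h'Th unfolding h'_def by auto
      done
    moreover have "\<forall>t\<in>topspace ?Y. h' (h t) = t"
      using hF h'F' Th by auto
    moreover have "\<forall>t\<in>topspace ?Y'. h (h' t) = t"
      using hh' by auto
    ultimately have "homeomorphic_map ?Y ?Y' h"
      by (auto simp: homeomorphic_map_maps homeomorphic_maps_def)
    then have "homeomorphic_map T ?Y' (h \<circ> ?F)"
      using lim unfolding limit_cone_def by (rule homeomorphic_map_compose[rotated])
    then show ?thesis
      unfolding limit_cone_def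
      by (rule homeomorphic_map_eq) (use hF in auto)
  qed
  show thesis
  proof (rule that[OF sys' L \<phi>'])
    show "finite (q k ` ?L)" if "k \<in> I'" for k
    proof -
      have "p (sel k) ` ?L \<subseteq> A (sel k)" using sel[OF that] pA by auto
      then have "finite (p (sel k) ` ?L)" using fin sel[OF that] finite_subset by blast
      then show ?thesis unfolding q_def image_comp[symmetric] by blast
    qed
    show "\<exists>i\<in>I. \<exists>e. inj_on e (A i) \<and> q k = e \<circ> p i" if "k \<in> I'" for k
      using sel[OF that] e unfolding q_def by blast
  qed (auto simp: r'_def)
qed

lemma inverse_system_cong:
  assumes "inverse_system I r A \<phi>" and eq: "\<And>i. i \<in> I \<Longrightarrow> A i = B i"
  shows "inverse_system I r B \<phi>"
proof -
  have "r \<subseteq> I \<times> I"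
    using assms(1) by (auto simp: inverse_system_def directed_poset_def order_on_defs)
  then have rI: "i \<in> I" "j \<in> I" if "(i, j) \<in> r" for i j
    using that by auto
  show ?thesis
    using assms(1) unfolding inverse_system_def by (simp add: eq[symmetric] rI)
qed

lemma limit_cone_cong:
  fixes A B :: "'i \<Rightarrow> 'c set"
  assumes lim: "limit_cone T I r A \<phi> p" and eq: "\<And>i. i \<in> I \<Longrightarrow> A i = B i"
  shows "limit_cone T I r B \<phi> p"
proof -
  let ?Y = "\<lambda>A. subtopology (product_topology (\<lambda>i. discrete_topology (A i)) I) (threads I r A \<phi>)"
  define h :: "('i \<Rightarrow> 'c) \<Rightarrow> 'i \<Rightarrow> 'c" where "h = (\<lambda>t. \<lambda>i\<in>I. id (t i))"
  have th: "threads I r A \<phi> = threads I r B \<phi>"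
    using eq by (simp add: threads_def cong: PiE_cong)
  have h: "h t = t" if "t \<in> threads I r B \<phi>" for t
    using that by (auto simp: h_def threads_def PiE_iff extensional_def)
  have AB: "continuous_map (?Y A) (?Y B) h"
    unfolding h_def
    by (rule continuous_map_product_discrete) (use h in \<open>auto simp: eq th h_def\<close>, auto simp: threads_def eq)
  have BA: "continuous_map (?Y B) (?Y A) h"
    unfolding h_def
    by (rule continuous_map_product_discrete) (use h in \<open>auto simp: eq th h_def\<close>, auto simp: threads_def eq)
  have "homeomorphic_map (?Y A) (?Y B) h"
    unfolding homeomorphic_map_maps homeomorphic_maps_def
    using AB BA h th by (intro exI[of _ h]) auto
  with lim have "homeomorphic_map T (?Y B) (h \<circ> (\<lambda>x. \<lambda>i\<in>I. p i x))"
    unfolding limit_cone_def by (rule homeomorphic_map_compose)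
  then show ?thesis
    unfolding limit_cone_def by (rule homeomorphic_map_eq) (auto simp: h_def)
qed

lemma semiring_pushforward:
  assumes S: "semiring S" and R: "semiring R" and p: "p \<in> semiring_hom S R"
    and e: "inj_on e (carrier R)"
  defines "q \<equiv> e \<circ> p"
  obtains N :: "'c ring" where "carrier N = q ` carrier S" "semiring N" "q \<in> semiring_hom S N"
proof -
  interpret S: semiring S by fact
  interpret R: semiring R by fact
  let ?L = "carrier S"
  have hom: "p (x \<oplus>\<^bsub>S\<^esub> y) = p x \<oplus>\<^bsub>R\<^esub> p y" "p (x \<otimes>\<^bsub>S\<^esub> y) = p x \<otimes>\<^bsub>R\<^esub> p y" "p x \<in> carrier R"
    if "x \<in> ?L" "y \<in> ?L" for x y
    using p that by (auto simp: semiring_hom_def ring_hom_def)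
  define g where "g y = inv_into ?L q y" for y
  have g: "g (q x) \<in> ?L" "p (g (q x)) = p x" if "x \<in> ?L" for x
  proof -
    show *: "g (q x) \<in> ?L" using that by (auto simp: g_def intro: inv_into_into)
    have "q (g (q x)) = q x" using that by (auto simp: g_def intro: f_inv_into_f)
    then show "p (g (q x)) = p x"
      using e hom(3) * that by (auto simp: q_def dest: inj_onD)
  qed
  define N :: "'c ring" where "N = \<lparr>carrier = q ` ?L, mult = (\<lambda>y z. q (g y \<otimes>\<^bsub>S\<^esub> g z)), one = q \<one>\<^bsub>S\<^esub>,
     zero = q \<zero>\<^bsub>S\<^esub>, add = (\<lambda>y z. q (g y \<oplus>\<^bsub>S\<^esub> g z))\<rparr>"
  have add: "q x \<oplus>\<^bsub>N\<^esub> q y = q (x \<oplus>\<^bsub>S\<^esub> y)" and mult: "q x \<otimes>\<^bsub>N\<^esub> q y = q (x \<otimes>\<^bsub>S\<^esub> y)"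
    if "x \<in> ?L" "y \<in> ?L" for x y
  proof -
    have "p (g (q x) \<oplus>\<^bsub>S\<^esub> g (q y)) = p (x \<oplus>\<^bsub>S\<^esub> y)" "p (g (q x) \<otimes>\<^bsub>S\<^esub> g (q y)) = p (x \<otimes>\<^bsub>S\<^esub> y)"
      using hom g that by auto
    then show "q x \<oplus>\<^bsub>N\<^esub> q y = q (x \<oplus>\<^bsub>S\<^esub> y)" "q x \<otimes>\<^bsub>N\<^esub> q y = q (x \<otimes>\<^bsub>S\<^esub> y)"
      by (simp_all add: N_def q_def)
  qed
  have N: "carrier N = q ` ?L" "\<one>\<^bsub>N\<^esub> = q \<one>\<^bsub>S\<^esub>" "\<zero>\<^bsub>N\<^esub> = q \<zero>\<^bsub>S\<^esub>" by (simp_all add: N_def)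
  have "semiring N"
    by (intro semiring.intro abelian_monoidI monoidI semiring_axioms.intro)
      (auto simp: N add mult S.a_ac S.m_assoc S.l_distr S.r_distr)
  moreover have "q \<in> semiring_hom S N"
    by (auto simp: semiring_hom_def ring_hom_def N add mult)
  ultimately show thesis using N(1) that by blast
qed

lemma semimodule_pushforward:
  assumes M: "semimodule S M" and R: "strongly_continuous_semimodule S TS R (discrete_topology (carrier R))"
    and TS: "topspace TS = carrier S"
    and p: "p \<in> semimodule_hom S M R" and e: "inj_on e (carrier R)"
  defines "q \<equiv> e \<circ> p"
  obtains N :: "('s, 'c) module" where "carrier N = q ` carrier M"
    "strongly_continuous_semimodule S TS N (discrete_topology (carrier N))" "q \<in> semimodule_hom S M N"
proof -
  interpret M: semimodule S M by fact
  have Rsm: "semimodule S R"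
    and Rc: "continuous_map (prod_topology TS (discrete_topology (carrier R))) (discrete_topology (carrier R)) (\<lambda>(s, x). s \<odot>\<^bsub>R\<^esub> x)"
    using R by (auto simp: strongly_continuous_semimodule_def)
  interpret R: semimodule S R by fact
  let ?L = "carrier M"
  have hom: "p (x \<oplus>\<^bsub>M\<^esub> y) = p x \<oplus>\<^bsub>R\<^esub> p y" "p x \<in> carrier R"
    if "x \<in> ?L" "y \<in> ?L" for x y
    using p that by (auto simp: semimodule_hom_def)
  have homs: "p (s \<odot>\<^bsub>M\<^esub> x) = s \<odot>\<^bsub>R\<^esub> p x" if "x \<in> ?L" "s \<in> carrier S" for x s
    using p that by (auto simp: semimodule_hom_def)
  define g where "g y = inv_into ?L q y" for y
  have g: "g (q x) \<in> ?L" "p (g (q x)) = p x" if "x \<in> ?L" for x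
  proof -
    show *: "g (q x) \<in> ?L" using that by (auto simp: g_def intro: inv_into_into)
    have "q (g (q x)) = q x" using that by (auto simp: g_def intro: f_inv_into_f)
    then show "p (g (q x)) = p x"
      using e hom(2) * that by (auto simp: q_def dest: inj_onD)
  qed
  define N :: "('s, 'c) module" where "N = \<lparr>carrier = q ` ?L, mult = undefined, one = undefined,
     zero = q \<zero>\<^bsub>M\<^esub>, add = (\<lambda>y z. q (g y \<oplus>\<^bsub>M\<^esub> g z)), smult = (\<lambda>s y. q (s \<odot>\<^bsub>M\<^esub> g y))\<rparr>"
  have add: "q x \<oplus>\<^bsub>N\<^esub> q y = q (x \<oplus>\<^bsub>M\<^esub> y)" if "x \<in> ?L" "y \<in> ?L" for x y
    using hom g that by (simp add: N_def q_def)
  have smult: "s \<odot>\<^bsub>N\<^esub> q x = q (s \<odot>\<^bsub>M\<^esub> x)" if "x \<in> ?L" "s \<in> carrier S" for x s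
    using homs g that by (simp add: N_def q_def)
  have N: "carrier N = q ` ?L" "\<zero>\<^bsub>N\<^esub> = q \<zero>\<^bsub>M\<^esub>" by (simp_all add: N_def)
  have "semimodule S N"
    by (intro semimodule.intro abelian_monoidI semimodule_axioms.intro M.R.semiring_axioms)
      (auto simp: N add smult M.M.a_ac M.smult_closed M.smult_r_distr M.smult_l_distr M.smult_assoc
        M.smult_one M.smult_l_null M.smult_r_null)
  moreover have "continuous_map (prod_topology TS (discrete_topology (carrier N))) (discrete_topology (carrier N))
      (\<lambda>(s, x). s \<odot>\<^bsub>N\<^esub> x)"
  proof -
    let ?D = "discrete_topology (carrier N)" and ?DR = "discrete_topology (carrier R)"
    have 1: "continuous_map (prod_topology TS ?D) TS fst" by (rule continuous_map_fst)
    have "continuous_map ?D ?DR (\<lambda>y. p (g y))"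
      using g hom(2) by (auto simp: N)
    from continuous_map_compose[OF continuous_map_snd this]
    have 2: "continuous_map (prod_topology TS ?D) ?DR (\<lambda>z. p (g (snd z)))"
      by (simp add: o_def)
    have "continuous_map (prod_topology TS ?D) (prod_topology TS ?DR) (\<lambda>z. (fst z, p (g (snd z))))"
      using 1 2 by (simp add: continuous_map_pairwise o_def)
    from continuous_map_compose[OF this Rc]
    have 3: "continuous_map (prod_topology TS ?D) ?DR (\<lambda>z. fst z \<odot>\<^bsub>R\<^esub> p (g (snd z)))"
      by (simp add: o_def)
    have 4: "continuous_map (prod_topology TS ?D) (subtopology ?DR (p ` ?L)) (\<lambda>z. fst z \<odot>\<^bsub>R\<^esub> p (g (snd z)))"
      unfolding continuous_map_in_subtopology
    proof (intro conjI 3, clarsimp simp: N TS)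
      fix s x assume "s \<in> carrier S" "x \<in> ?L"
      then show "s \<odot>\<^bsub>R\<^esub> p (g (q x)) \<in> p ` ?L"
        using g homs[of x s] M.smult_closed by (metis imageI)
    qed
    have "continuous_map (subtopology ?DR (p ` ?L)) ?D e"
      by (auto simp: N q_def)
    from continuous_map_compose[OF 4 this]
    have 5: "continuous_map (prod_topology TS ?D) ?D (\<lambda>z. e (fst z \<odot>\<^bsub>R\<^esub> p (g (snd z))))"
      by (simp add: o_def)
    show ?thesis
    proof (rule continuous_map_eq[OF 5], clarsimp simp: N TS)
      fix s x assume "s \<in> carrier S" "x \<in> ?L"
      then show "e (s \<odot>\<^bsub>R\<^esub> p (g (q x))) = s \<odot>\<^bsub>N\<^esub> q x"
        using g homs by (simp add: smult) (simp add: q_def)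
    qed
  qed
  moreover have "continuous_map (prod_topology (discrete_topology (carrier N)) (discrete_topology (carrier N)))
      (discrete_topology (carrier N)) (\<lambda>(x, y). x \<oplus>\<^bsub>N\<^esub> y)"
    by (auto simp: prod_topology_discrete_topology[symmetric] N add)
  ultimately have "strongly_continuous_semimodule S TS N (discrete_topology (carrier N))"
    by (simp add: strongly_continuous_semimodule_def)
  moreover have "q \<in> semimodule_hom S M N"
    by (auto simp: semimodule_hom_def N add smult)
  ultimately show thesis using N(1) that by blast
qed

theorem profinite_semiringI:
  assumes "limit_of_finite_semirings S TS I r N \<phi> p"
  shows "profinite_semiring S TS"
proof -
  have S: "semiring S" and TS: "topspace TS = carrier S"
    and N: "\<And>i. i \<in> I \<Longrightarrow> semiring (N i) \<and> finite (carrier (N i))"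
    and sys: "inverse_system I r (\<lambda>i. carrier (N i)) \<phi>"
    and p: "\<And>i. i \<in> I \<Longrightarrow> p i \<in> semiring_hom S (N i)"
    and lim: "limit_cone TS I r (\<lambda>i. carrier (N i)) \<phi> p"
    using assms by (auto simp: limit_of_finite_semirings_def)
  interpret S: semiring S by fact
  have ne: "\<exists>x. x \<in> topspace TS" using TS S.zero_closed by blast
  have fin0: "\<And>i. i \<in> I \<Longrightarrow> finite (carrier (N i))" using N by blast
  obtain I' :: "('a \<times> 'a) set set" and r' \<phi>' and q :: "('a \<times> 'a) set \<Rightarrow> 'a \<Rightarrow> nat"
    where sys': "inverse_system I' r' (\<lambda>k. q k ` topspace TS) \<phi>'"
      and lim': "limit_cone TS I' r' (\<lambda>k. q k ` topspace TS) \<phi>' q"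
      and \<phi>': "\<And>k l x. (k, l) \<in> r' \<Longrightarrow> x \<in> topspace TS \<Longrightarrow> \<phi>' k l (q l x) = q k x"
      and rI: "\<And>k l. (k, l) \<in> r' \<Longrightarrow> k \<in> I' \<and> l \<in> I'"
      and fin: "\<And>k. k \<in> I' \<Longrightarrow> finite (q k ` topspace TS)"
      and q: "\<And>k. k \<in> I' \<Longrightarrow> \<exists>i\<in>I. \<exists>e. inj_on e (carrier (N i)) \<and> q k = e \<circ> p i"
    by (rule limit_cone_reindex[OF sys lim fin0 ne], assumption) (rule that)
  have "\<exists>N' :: nat ring. carrier N' = q k ` carrier S \<and> semiring N' \<and> q k \<in> semiring_hom S N'" if k: "k \<in> I'" for k
  proof -
    obtain i e where ie: "i \<in> I" "inj_on e (carrier (N i))" "q k = e \<circ> p i" using q[OF k] by blast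
    show ?thesis
      using semiring_pushforward[OF S _ p ie(2)] N ie(1,3) by metis
  qed
  then obtain N' :: "('a \<times> 'a) set \<Rightarrow> nat ring" where
    N': "\<And>k. k \<in> I' \<Longrightarrow> carrier (N' k) = q k ` carrier S \<and> semiring (N' k) \<and> q k \<in> semiring_hom S (N' k)"
    by metis
  have hom: "\<phi>' k l \<in> semiring_hom (N' l) (N' k)" if kl: "(k, l) \<in> r'" for k l
  proof -
    have I: "k \<in> I'" "l \<in> I'" using rI kl by auto
    have ql: "q l (x \<oplus>\<^bsub>S\<^esub> y) = q l x \<oplus>\<^bsub>N' l\<^esub> q l y" "q l (x \<otimes>\<^bsub>S\<^esub> y) = q l x \<otimes>\<^bsub>N' l\<^esub> q l y"
      and qk: "q k (x \<oplus>\<^bsub>S\<^esub> y) = q k x \<oplus>\<^bsub>N' k\<^esub> q k y" "q k (x \<otimes>\<^bsub>S\<^esub> y) = q k x \<otimes>\<^bsub>N' k\<^esub> q k y"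
      if "x \<in> carrier S" "y \<in> carrier S" for x y
      using N'[OF I(1)] N'[OF I(2)] that by (auto simp: semiring_hom_def ring_hom_def)
    have c: "q l \<one>\<^bsub>S\<^esub> = \<one>\<^bsub>N' l\<^esub>" "q l \<zero>\<^bsub>S\<^esub> = \<zero>\<^bsub>N' l\<^esub>"
      "q k \<one>\<^bsub>S\<^esub> = \<one>\<^bsub>N' k\<^esub>" "q k \<zero>\<^bsub>S\<^esub> = \<zero>\<^bsub>N' k\<^esub>"
      using N'[OF I(1)] N'[OF I(2)] by (auto simp: semiring_hom_def ring_hom_def)
    note f = \<phi>'[OF kl, unfolded TS]
    have one: "\<phi>' k l \<one>\<^bsub>N' l\<^esub> = \<one>\<^bsub>N' k\<^esub>" using f[OF S.one_closed] by (simp add: c)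
    have zero: "\<phi>' k l \<zero>\<^bsub>N' l\<^esub> = \<zero>\<^bsub>N' k\<^esub>" using f[OF S.zero_closed] by (simp add: c)
    show ?thesis
      unfolding semiring_hom_def ring_hom_def
      using conjunct1[OF N'[OF I(1)]] conjunct1[OF N'[OF I(2)]] one zero
      by (auto simp: f qk simp flip: ql)
  qed
  have sys'': "inverse_system I' r' (\<lambda>k. carrier (N' k)) \<phi>'"
    by (rule inverse_system_cong[OF sys']) (use N' TS in simp)
  have lim'': "limit_cone TS I' r' (\<lambda>k. carrier (N' k)) \<phi>' q"
    by (rule limit_cone_cong[OF lim']) (use N' TS in simp)
  have "limit_of_finite_semirings S TS I' r' N' \<phi>' q"
    using S TS N' fin hom sys'' lim'' by (auto simp: limit_of_finite_semirings_def)
  then show ?thesis unfolding profinite_semiring_def by blast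
qed

theorem profinite_semimoduleI:
  assumes M: "strongly_continuous_semimodule S TS M TM" and TS: "topspace TS = carrier S"
    and "limit_of_finite_semimodules S TS M TM I r N \<phi> p"
  shows "profinite_semimodule S TS M TM"
proof -
  have N: "\<And>i. i \<in> I \<Longrightarrow> finite (carrier (N i)) \<and>
        strongly_continuous_semimodule S TS (N i) (discrete_topology (carrier (N i)))"
    and sys: "inverse_system I r (\<lambda>i. carrier (N i)) \<phi>"
    and p: "\<And>i. i \<in> I \<Longrightarrow> p i \<in> semimodule_hom S M (N i)"
    and lim: "limit_cone TM I r (\<lambda>i. carrier (N i)) \<phi> p"
    using assms(3) by (auto simp: limit_of_finite_semimodules_def)
  have Msm: "semimodule S M" and TM: "topspace TM = carrier M"
    using M by (auto simp: strongly_continuous_semimodule_def)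
  interpret M: semimodule S M by fact
  have ne: "\<exists>x. x \<in> topspace TM" using TM M.M.zero_closed by blast
  have fin0: "\<And>i. i \<in> I \<Longrightarrow> finite (carrier (N i))" using N by blast
  obtain I' :: "('b \<times> 'b) set set" and r' \<phi>' and q :: "('b \<times> 'b) set \<Rightarrow> 'b \<Rightarrow> nat"
    where sys': "inverse_system I' r' (\<lambda>k. q k ` topspace TM) \<phi>'"
      and lim': "limit_cone TM I' r' (\<lambda>k. q k ` topspace TM) \<phi>' q"
      and \<phi>': "\<And>k l x. (k, l) \<in> r' \<Longrightarrow> x \<in> topspace TM \<Longrightarrow> \<phi>' k l (q l x) = q k x"
      and rI: "\<And>k l. (k, l) \<in> r' \<Longrightarrow> k \<in> I' \<and> l \<in> I'"
      and fin: "\<And>k. k \<in> I' \<Longrightarrow> finite (q k ` topspace TM)"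
      and q: "\<And>k. k \<in> I' \<Longrightarrow> \<exists>i\<in>I. \<exists>e. inj_on e (carrier (N i)) \<and> q k = e \<circ> p i"
    by (rule limit_cone_reindex[OF sys lim fin0 ne], assumption) (rule that)
  have "\<exists>N' :: ('a, nat) module. carrier N' = q k ` carrier M \<and>
      strongly_continuous_semimodule S TS N' (discrete_topology (carrier N')) \<and>
      q k \<in> semimodule_hom S M N'" if k: "k \<in> I'" for k
  proof -
    obtain i e where ie: "i \<in> I" "inj_on e (carrier (N i))" "q k = e \<circ> p i" using q[OF k] by blast
    show ?thesis
      using semimodule_pushforward[OF Msm _ TS p ie(2)] N ie(1,3) by metis
  qed
  then obtain N' :: "('b \<times> 'b) set \<Rightarrow> ('a, nat) module" where
    N': "\<And>k. k \<in> I' \<Longrightarrow> carrier (N' k) = q k ` carrier M \<and>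
      strongly_continuous_semimodule S TS (N' k) (discrete_topology (carrier (N' k))) \<and>
      q k \<in> semimodule_hom S M (N' k)"
    by metis
  have hom: "\<phi>' k l \<in> semimodule_hom S (N' l) (N' k)" if kl: "(k, l) \<in> r'" for k l
  proof -
    have I: "k \<in> I'" "l \<in> I'" using rI kl by auto
    have ql: "q l (x \<oplus>\<^bsub>M\<^esub> y) = q l x \<oplus>\<^bsub>N' l\<^esub> q l y"
      and qk: "q k (x \<oplus>\<^bsub>M\<^esub> y) = q k x \<oplus>\<^bsub>N' k\<^esub> q k y"
      if "x \<in> carrier M" "y \<in> carrier M" for x y
      using N'[OF I(1)] N'[OF I(2)] that by (auto simp: semimodule_hom_def)
    have qls: "q l (s \<odot>\<^bsub>M\<^esub> x) = s \<odot>\<^bsub>N' l\<^esub> q l x" and qks: "q k (s \<odot>\<^bsub>M\<^esub> x) = s \<odot>\<^bsub>N' k\<^esub> q k x"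
      if "x \<in> carrier M" "s \<in> carrier S" for x s
      using N'[OF I(1)] N'[OF I(2)] that by (auto simp: semimodule_hom_def)
    have c: "q l \<zero>\<^bsub>M\<^esub> = \<zero>\<^bsub>N' l\<^esub>" "q k \<zero>\<^bsub>M\<^esub> = \<zero>\<^bsub>N' k\<^esub>"
      using N'[OF I(1)] N'[OF I(2)] by (auto simp: semimodule_hom_def)
    note f = \<phi>'[OF kl, unfolded TM]
    have zero: "\<phi>' k l \<zero>\<^bsub>N' l\<^esub> = \<zero>\<^bsub>N' k\<^esub>" using f[OF M.M.zero_closed] by (simp add: c)
    show ?thesis
      unfolding semimodule_hom_def
      using conjunct1[OF N'[OF I(1)]] conjunct1[OF N'[OF I(2)]] zero
      by (auto simp: f qk qks M.smult_closed simp flip: ql qls)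
  qed
  have sys'': "inverse_system I' r' (\<lambda>k. carrier (N' k)) \<phi>'"
    by (rule inverse_system_cong[OF sys']) (use N' TM in simp)
  have lim'': "limit_cone TM I' r' (\<lambda>k. carrier (N' k)) \<phi>' q"
    by (rule limit_cone_cong[OF lim']) (use N' TM in simp)
  have "finite (carrier (N' k))" if "k \<in> I'" for k
    using N'[OF that] fin[OF that] TM by simp
  then have "limit_of_finite_semimodules S TS M TM I' r' N' \<phi>' q"
    unfolding limit_of_finite_semimodules_def using N' hom sys'' lim'' by blast
  then show ?thesis unfolding profinite_semimodule_def using M by blast
qed

end

theory Submission
  imports Defs
begin

text \<open>
  A compact strongly continuous semimodule whose points are separated by open congruences is the
  limit of its finite quotients.  Measures are separated by the congruences
  \<open>p (\<mu> b) = p (\<nu> b)\<close> with \<open>b\<close> clopen and \<open>p\<close> a continuous homomorphism to a finite stage of \<open>S\<close>.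

  Uniqueness: every measure agrees on any given finite family of clopen sets with some
  combination of Dirac measures, so these combinations are dense.  Existence: against a finite
  discrete semimodule \<open>N\<close>, a continuous \<open>f\<close> extends to
  \<open>\<mu> \<mapsto> \<Sum>\<^sub>n \<mu> (f\<^sup>-\<^sup>1 n) \<cdot> n\<close>; uniqueness makes the extensions to the finite
  stages of \<open>Y\<close> compatible, so they assemble to a map into the limit.
\<close>

section \<open>Limits of finite discrete spaces\<close>

text \<open>Two obstacles shape the argument. An explicit inverse system for the measures would be
  indexed by pairs of a finite clopen partition of the space and a finite stage of the semiring,
  with transition maps to check. The congruence criterion asks instead for one open congruence per
  pair of distinct points; compactness then realizes every thread, so no partition has to be named.
  The extension of \<open>f\<close> cannot be written as a finite sum in the target itself, since
  \<open>f\<close> may take infinitely many values there. After projection to a finite discrete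
  stage it takes finitely many, each on a clopen set. The sum is continuous in the measure because
  each map \<open>s \<mapsto> s n\<close> is continuous; this is where strong continuity of the
  stages enters.\<close>

lemma inverse_system_Field:
  assumes "inverse_system I r A \<phi>" and "(i, j) \<in> r"
  shows "i \<in> I" and "j \<in> I"
  using assms by (auto simp: inverse_system_def directed_poset_def order_on_defs)

lemma continuous_map_discreteI:
  assumes "\<And>x. x \<in> topspace X \<Longrightarrow> f x \<in> U"
    and "\<And>u. u \<in> U \<Longrightarrow> openin X {x \<in> topspace X. f x = u}"
  shows "continuous_map X (discrete_topology U) f"
  unfolding continuous_map_def
proof (intro conjI allI impI)
  fix V assume "openin (discrete_topology U) V"
  then have "openin X (\<Union>u\<in>V. {x \<in> topspace X. f x = u})"
    using assms(2) by auto
  moreover have "(\<Union>u\<in>V. {x \<in> topspace X. f x = u}) = {x \<in> topspace X. f x \<in> V}"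
    by auto
  ultimately show "openin X {x \<in> topspace X. f x \<in> V}"
    by simp
qed (use assms(1) in auto)

lemma clopen_fibre_discrete:
  assumes "continuous_map X (discrete_topology U) f"
  shows "openin X {x \<in> topspace X. f x \<in> V}" and "closedin X {x \<in> topspace X. f x \<in> V}"
proof -
  have eq: "{x \<in> topspace X. f x \<in> V} = {x \<in> topspace X. f x \<in> V \<inter> U}"
    using continuous_map_funspace[OF assms] by auto
  show "openin X {x \<in> topspace X. f x \<in> V}" "closedin X {x \<in> topspace X. f x \<in> V}"
    unfolding eq
    using openin_continuous_map_preimage[OF assms, of "V \<inter> U"]
      closedin_continuous_map_preimage[OF assms, of "V \<inter> U"] by auto
qed

lemma limit_cone_continuous_proj:
  assumes "limit_cone T I r A \<phi> p" and "i \<in> I"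
  shows "continuous_map T (discrete_topology (A i)) (p i)"
proof -
  have "continuous_map T (product_topology (\<lambda>i. discrete_topology (A i)) I) (\<lambda>x. \<lambda>i\<in>I. p i x)"
    using homeomorphic_imp_continuous_map[OF assms(1)[unfolded limit_cone_def]]
    by (simp add: continuous_map_in_subtopology)
  then have "continuous_map T (discrete_topology (A i)) (\<lambda>x. (\<lambda>i\<in>I. p i x) i)"
    using assms(2) by (simp add: continuous_map_componentwise)
  then show ?thesis
    using assms(2) by simp
qed

lemma limit_cone_eqI:
  assumes lim: "limit_cone T I r A \<phi> p" and x: "x \<in> topspace T" "y \<in> topspace T"
    and eq: "\<And>i. i \<in> I \<Longrightarrow> p i x = p i y"
  shows "x = y"
proof -
  have "inj_on (\<lambda>x. \<lambda>i\<in>I. p i x) (topspace T)"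
    using homeomorphic_imp_injective_map[OF lim[unfolded limit_cone_def]] .
  moreover have "(\<lambda>i\<in>I. p i x) = (\<lambda>i\<in>I. p i y)"
    using eq by (auto simp: restrict_def)
  ultimately show ?thesis
    using x by (auto dest: inj_onD)
qed

text \<open>Surjectivity onto threads is the source of existence: points of a limit are built from
  their values at the stages.\<close>

lemma limit_cone_threadE:
  assumes lim: "limit_cone T I r A \<phi> p" and t: "\<And>i. i \<in> I \<Longrightarrow> t i \<in> A i"
    and comp: "\<And>i j. (i, j) \<in> r \<Longrightarrow> i \<in> I \<and> j \<in> I \<and> \<phi> i j (t j) = t i"
  obtains x where "x \<in> topspace T" "\<And>i. i \<in> I \<Longrightarrow> p i x = t i"
proof -
  have "(\<lambda>i\<in>I. t i) \<in> threads I r A \<phi>"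
    unfolding threads_def using t comp by auto
  then obtain x where "x \<in> topspace T" "(\<lambda>i\<in>I. p i x) = (\<lambda>i\<in>I. t i)"
    using limit_coneD(1)[OF lim] by (metis (no_types, lifting) imageE)
  then show thesis
    using that by (metis restrict_apply')
qed

text \<open>The topology of a limit is initial for its projections. The thread of \<open>g z\<close>
  depends continuously on \<open>z\<close>, and the inverse of the limit homeomorphism carries it
  back to \<open>g z\<close>.\<close>

lemma limit_cone_continuous_mapI:
  assumes lim: "limit_cone T I r A \<phi> p" and g: "\<And>z. z \<in> topspace Z \<Longrightarrow> g z \<in> topspace T"
    and cont: "\<And>i. i \<in> I \<Longrightarrow> continuous_map Z (discrete_topology (A i)) (\<lambda>z. p i (g z))"
  shows "continuous_map Z T g"
proof -
  let ?P = "product_topology (\<lambda>i. discrete_topology (A i)) I"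
  let ?h = "\<lambda>x. \<lambda>i\<in>I. p i x"
  obtain k where k: "homeomorphic_maps T (subtopology ?P (threads I r A \<phi>)) ?h k"
    using lim by (auto simp: limit_cone_def homeomorphic_map_maps)
  have "continuous_map Z ?P (\<lambda>z. ?h (g z))"
    using cont by (auto simp: continuous_map_componentwise)
  moreover have "?h (g z) \<in> threads I r A \<phi>" if "z \<in> topspace Z" for z
    using g[OF that] limit_coneD(1)[OF lim] by blast
  ultimately have "continuous_map Z (subtopology ?P (threads I r A \<phi>)) (\<lambda>z. ?h (g z))"
    by (auto simp: continuous_map_in_subtopology)
  then have "continuous_map Z T (k \<circ> (\<lambda>z. ?h (g z)))"
    using k by (auto simp: homeomorphic_maps_def intro: continuous_map_compose)
  then show ?thesis
    by (rule continuous_map_eq) (use k g in \<open>auto simp: homeomorphic_maps_def\<close>)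
qed

lemma limit_cone_homeomorphic_space:
  assumes "limit_cone T I r A \<phi> p"
  shows "T homeomorphic_space
    subtopology (product_topology (\<lambda>i. discrete_topology (A i)) I) (threads I r A \<phi>)"
  using assms unfolding limit_cone_def by (rule homeomorphic_map_imp_homeomorphic_space)

lemma limit_cone_Hausdorff:
  assumes "limit_cone T I r A \<phi> p"
  shows "Hausdorff_space T"
  using homeomorphic_Hausdorff_space[OF limit_cone_homeomorphic_space[OF assms]]
  by (simp add: Hausdorff_space_subtopology Hausdorff_space_product_topology)

text \<open>Each compatibility equation equates two continuous maps into a discrete, hence
  Hausdorff, space, so it cuts out a closed set; the threads are the intersection of these
  sets.\<close>

lemma closedin_threads:
  assumes sys: "inverse_system I r A \<phi>"
  shows "closedin (product_topology (\<lambda>i. discrete_topology (A i)) I) (threads I r A \<phi>)"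
proof -
  let ?P = "product_topology (\<lambda>i. discrete_topology (A i)) I"
  let ?E = "\<lambda>(i, j). {t \<in> topspace ?P. \<phi> i j (t j) = t i}"
  have "closedin ?P (?E (i, j))" if ij: "(i, j) \<in> r" for i j
  proof -
    note I = inverse_system_Field[OF sys ij]
    have "continuous_map ?P (discrete_topology (A j)) (\<lambda>t. t j)"
      and ci: "continuous_map ?P (discrete_topology (A i)) (\<lambda>t. t i)"
      using I continuous_map_product_projection[of _ I "\<lambda>i. discrete_topology (A i)"] by auto
    moreover have "continuous_map (discrete_topology (A j)) (discrete_topology (A i)) (\<phi> i j)"
      using sys ij by (auto simp: inverse_system_def)
    ultimately have "continuous_map ?P (discrete_topology (A i)) (\<lambda>t. \<phi> i j (t j))"
      using continuous_map_compose[unfolded o_def] by blast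
    then show ?thesis
      using closedin_continuous_maps_eq[OF _ _ ci] by simp
  qed
  \<comment> \<open>Inserting \<open>topspace ?P\<close> keeps the family visibly nonempty, as
    \<open>closedin_Inter\<close> requires.\<close>
  then have "closedin ?P C" if "C \<in> insert (topspace ?P) (?E ` r)" for C
    using that by (auto simp del: topspace_product_topology)
  then have "closedin ?P (\<Inter> (insert (topspace ?P) (?E ` r)))"
    by (intro closedin_Inter) auto
  moreover have "\<Inter> (insert (topspace ?P) (?E ` r)) = threads I r A \<phi>"
    by (auto simp: threads_def)
  ultimately show ?thesis
    by simp
qed

lemma limit_cone_compact:
  assumes "inverse_system I r A \<phi>" and "limit_cone T I r A \<phi> p" and "\<And>i. i \<in> I \<Longrightarrow> finite (A i)"
  shows "compact_space T"
proof -
  have "compact_space (product_topology (\<lambda>i. discrete_topology (A i)) I)"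
    using assms(3) by (simp add: compact_space_product_topology compact_space_discrete_topology)
  then show ?thesis
    using closedin_threads[OF assms(1)] closedin_compact_space compact_space_subtopology
      homeomorphic_compact_space[OF limit_cone_homeomorphic_space[OF assms(2)]] by blast
qed

section \<open>Open congruences\<close>

text \<open>On a compact strongly continuous semimodule these are the kernels of continuous
  homomorphisms to finite discrete ones: open classes make the quotient discrete, and compactness
  leaves finitely many of them. The scalar is the same on both sides, so the quotient is again a
  semimodule over \<open>S\<close>.\<close>

definition open_congruence ::
  "'s ring \<Rightarrow> ('s, 'a) module \<Rightarrow> 'a topology \<Rightarrow> ('a \<times> 'a) set \<Rightarrow> bool" where
  "open_congruence S M TM \<theta> \<longleftrightarrow> equiv (carrier M) \<theta> \<and>
     (\<forall>x\<in>carrier M. openin TM (\<theta> `` {x})) \<and>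
     (\<forall>(x, x')\<in>\<theta>. \<forall>(y, y')\<in>\<theta>. (x \<oplus>\<^bsub>M\<^esub> y, x' \<oplus>\<^bsub>M\<^esub> y') \<in> \<theta>) \<and>
     (\<forall>s\<in>carrier S. \<forall>(x, x')\<in>\<theta>. (s \<odot>\<^bsub>M\<^esub> x, s \<odot>\<^bsub>M\<^esub> x') \<in> \<theta>)"

text \<open>For a congruence all sets in each union coincide, so the operations need no choice of
  representatives.\<close>

definition quotient_semimodule :: "('s, 'a) module \<Rightarrow> ('a \<times> 'a) set \<Rightarrow> ('s, 'a set) module" where
  "quotient_semimodule M \<theta> =
     \<lparr>carrier = carrier M // \<theta>, mult = undefined, one = undefined, zero = \<theta> `` {\<zero>\<^bsub>M\<^esub>},
      add = (\<lambda>C D. \<Union>x\<in>C. \<Union>y\<in>D. \<theta> `` {x \<oplus>\<^bsub>M\<^esub> y}),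
      smult = (\<lambda>s C. \<Union>x\<in>C. \<theta> `` {s \<odot>\<^bsub>M\<^esub> x})\<rparr>"

locale compact_semimodule_congruence =
  fixes S :: "'s ring" and TS :: "'s topology" and M :: "('s, 'a) module" and TM :: "'a topology"
    and \<theta> :: "('a \<times> 'a) set"
  assumes M: "strongly_continuous_semimodule S TS M TM" and TS: "topspace TS = carrier S"
    and compact: "compact_space TM" and \<theta>: "open_congruence S M TM \<theta>"
begin

sublocale semimodule S M
  using M by (simp add: strongly_continuous_semimodule_def)

abbreviation "Q \<equiv> quotient_semimodule M \<theta>"

lemma equiv: "equiv (carrier M) \<theta>"
  using \<theta> by (simp add: open_congruence_def)

lemma topspace_TM: "topspace TM = carrier M"
  using M by (simp add: strongly_continuous_semimodule_def)

lemma carrier_Q: "carrier Q = (\<lambda>x. \<theta> `` {x}) ` carrier M"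
  by (auto simp: quotient_semimodule_def quotient_def)

lemma zero_Q: "\<zero>\<^bsub>Q\<^esub> = \<theta> `` {\<zero>\<^bsub>M\<^esub>}"
  by (simp add: quotient_semimodule_def)

lemma add_Q:
  assumes "x \<in> carrier M" "y \<in> carrier M"
  shows "\<theta> `` {x} \<oplus>\<^bsub>Q\<^esub> \<theta> `` {y} = \<theta> `` {x \<oplus>\<^bsub>M\<^esub> y}"
proof -
  have "congruent2 \<theta> \<theta> (\<lambda>x y. \<theta> `` {x \<oplus>\<^bsub>M\<^esub> y})"
    unfolding congruent2_def
    by clarify (rule equiv_class_eq[OF equiv], use \<theta> in \<open>auto simp: open_congruence_def\<close>)
  from UN_equiv_class2[OF equiv equiv this] assms show ?thesis
    by (simp add: quotient_semimodule_def)
qed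

lemma smult_Q:
  assumes "s \<in> carrier S" "x \<in> carrier M"
  shows "s \<odot>\<^bsub>Q\<^esub> \<theta> `` {x} = \<theta> `` {s \<odot>\<^bsub>M\<^esub> x}"
proof -
  have "(\<lambda>x. \<theta> `` {s \<odot>\<^bsub>M\<^esub> x}) respects \<theta>"
    unfolding congruent_def
    by clarify (rule equiv_class_eq[OF equiv], use \<theta> assms(1) in \<open>auto simp: open_congruence_def\<close>)
  from UN_equiv_class[OF equiv this] assms show ?thesis
    by (simp add: quotient_semimodule_def)
qed

lemma semimodule_Q: "semimodule S Q"
  by (intro semimodule.intro abelian_monoidI semimodule_axioms.intro R.semiring_axioms)
    (auto simp: carrier_Q zero_Q add_Q smult_Q M.a_ac smult_closed smult_r_distr smult_l_distr
      smult_assoc smult_one smult_l_null smult_r_null)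

lemma class_hom: "(\<lambda>x. \<theta> `` {x}) \<in> semimodule_hom S M Q"
  by (auto simp: semimodule_hom_def carrier_Q zero_Q add_Q smult_Q)

lemma continuous_class: "continuous_map TM (discrete_topology (carrier Q)) (\<lambda>x. \<theta> `` {x})"
proof (rule continuous_map_discreteI)
  fix C assume "C \<in> carrier Q"
  then obtain x where x: "x \<in> carrier M" "C = \<theta> `` {x}"
    by (auto simp: carrier_Q)
  have "{y \<in> topspace TM. \<theta> `` {y} = C} = \<theta> `` {x}"
    using x equiv_class_eq_iff[OF equiv] equiv_type[OF equiv] by (auto simp: topspace_TM)
  then show "openin TM {y \<in> topspace TM. \<theta> `` {y} = C}"
    using \<theta> x by (simp add: open_congruence_def)
qed (auto simp: carrier_Q topspace_TM)

lemma finite_Q: "finite (carrier Q)"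
proof -
  have "compactin (discrete_topology (carrier Q)) ((\<lambda>x. \<theta> `` {x}) ` topspace TM)"
    using image_compactin[OF _ continuous_class] compact by (simp add: compact_space_def)
  then show ?thesis
    by (simp add: compactin_discrete_topology topspace_TM carrier_Q)
qed

text \<open>The action on the quotient factors through the one on \<open>M\<close>: choose
  representatives, act, pass to classes. The choice \<open>g\<close> is continuous because its
  domain is discrete, so joint continuity is inherited.\<close>

lemma strongly_continuous_Q:
  "strongly_continuous_semimodule S TS Q (discrete_topology (carrier Q))"
proof -
  let ?D = "discrete_topology (carrier Q)"
  define g where "g C = (SOME x. x \<in> carrier M \<and> C = \<theta> `` {x})" for C
  have g: "g C \<in> carrier M \<and> C = \<theta> `` {g C}" if "C \<in> carrier Q" for C
    unfolding g_def by (rule someI_ex) (use that in \<open>auto simp: carrier_Q\<close>)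
  have "continuous_map ?D TM g"
    using g by (auto simp: topspace_TM)
  then have "continuous_map (prod_topology TS ?D) TM (\<lambda>z. g (snd z))"
    using continuous_map_compose[OF continuous_map_snd, unfolded o_def] by blast
  then have "continuous_map (prod_topology TS ?D) (prod_topology TS TM) (\<lambda>z. (fst z, g (snd z)))"
    by (intro continuous_map_pairedI continuous_map_fst)
  moreover have "continuous_map (prod_topology TS TM) TM (\<lambda>(s, x). s \<odot>\<^bsub>M\<^esub> x)"
    using M by (simp add: strongly_continuous_semimodule_def)
  ultimately have "continuous_map (prod_topology TS ?D) TM (\<lambda>z. fst z \<odot>\<^bsub>M\<^esub> g (snd z))"
    using continuous_map_compose[unfolded o_def] by fastforce
  then have "continuous_map (prod_topology TS ?D) ?D (\<lambda>z. \<theta> `` {fst z \<odot>\<^bsub>M\<^esub> g (snd z)})"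
    using continuous_map_compose[OF _ continuous_class, unfolded o_def] by blast
  then have "continuous_map (prod_topology TS ?D) ?D (\<lambda>(s, x). s \<odot>\<^bsub>Q\<^esub> x)"
  proof (rule continuous_map_eq, clarsimp simp: TS)
    fix s C assume "s \<in> carrier S" "C \<in> carrier Q"
    then show "\<theta> `` {s \<odot>\<^bsub>M\<^esub> g C} = s \<odot>\<^bsub>Q\<^esub> C"
      using g smult_Q by metis
  qed
  moreover have "continuous_map (prod_topology ?D ?D) ?D (\<lambda>(x, y). x \<oplus>\<^bsub>Q\<^esub> y)"
    by (auto simp: prod_topology_discrete_topology[symmetric] carrier_Q add_Q)
  ultimately show ?thesis
    using semimodule_Q by (simp add: strongly_continuous_semimodule_def)
qed

end

text \<open>Supplies the upper bounds that make the index set of open congruences directed.\<close>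

lemma open_congruence_Int:
  assumes "open_congruence S M TM \<theta>" and "open_congruence S M TM \<theta>'"
  shows "open_congruence S M TM (\<theta> \<inter> \<theta>')"
proof -
  have "equiv (carrier M) (\<theta> \<inter> \<theta>')"
  proof (rule equivI)
    have \<theta>: "equiv (carrier M) \<theta>" "equiv (carrier M) \<theta>'"
      using assms by (simp_all add: open_congruence_def)
    show "\<theta> \<inter> \<theta>' \<subseteq> carrier M \<times> carrier M"
      using equiv_type[OF \<theta>(1)] by blast
    show "refl_on (carrier M) (\<theta> \<inter> \<theta>')"
      using \<theta> by (simp add: equiv_def refl_on_def)
    show "sym (\<theta> \<inter> \<theta>')" "trans (\<theta> \<inter> \<theta>')"
      using \<theta> by (simp_all add: equiv_def sym_Int trans_Int)
  qed
  moreover have "(\<theta> \<inter> \<theta>') `` {x} = \<theta> `` {x} \<inter> \<theta>' `` {x}" for x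
    by auto
  ultimately show ?thesis
    using assms by (auto simp: open_congruence_def intro: openin_Int)
qed

lemma open_congruence_total:
  assumes "semimodule S M" and "topspace TM = carrier M"
  shows "open_congruence S M TM (carrier M \<times> carrier M)"
proof -
  interpret semimodule S M by fact
  have "(carrier M \<times> carrier M) `` {x} = topspace TM" if "x \<in> carrier M" for x
    using that assms(2) by auto
  then show ?thesis
    by (auto simp: open_congruence_def equiv_def refl_on_def sym_def trans_def smult_closed)
qed

text \<open>All open congruences, ordered by reverse inclusion, index the system of quotients.
  Separation makes the map to threads injective; compactness makes it surjective, since a thread is
  a family of closed classes with the finite intersection property. A continuous bijection from a
  compact space to a Hausdorff space is then a homeomorphism.\<close>

lemma profinite_semimodule_if_separated:
  fixes M :: "('s, 'a) module"
  assumes M: "strongly_continuous_semimodule S TS M TM" and TS: "topspace TS = carrier S"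
    and compact: "compact_space TM"
    and sep: "\<And>x y. x \<in> carrier M \<Longrightarrow> y \<in> carrier M \<Longrightarrow> x \<noteq> y \<Longrightarrow>
      \<exists>\<theta>. open_congruence S M TM \<theta> \<and> (x, y) \<notin> \<theta>"
  shows "profinite_semimodule S TS M TM"
proof -
  let ?K = "{\<theta>. open_congruence S M TM \<theta>}"
  define r where "r = {(\<theta>, \<theta>'). \<theta> \<in> ?K \<and> \<theta>' \<in> ?K \<and> \<theta>' \<subseteq> \<theta>}"
  \<comment> \<open>The relational image under a coarser congruence \<open>\<theta>\<close> sends
    the class of \<open>x\<close> for \<open>\<theta>'\<close> to its class for
    \<open>\<theta>\<close>.\<close>
  define \<phi> where "\<phi> \<theta> (\<theta>' :: ('a \<times> 'a) set) C = \<theta> `` C" for \<theta> \<theta>' :: "('a \<times> 'a) set" and C :: "'a set"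
  let ?N = "quotient_semimodule M" and ?A = "\<lambda>\<theta>. carrier (quotient_semimodule M \<theta>)"
  let ?p = "\<lambda>\<theta> x. \<theta> `` {x}"
  have loc: "compact_semimodule_congruence S TS M TM \<theta>" if "\<theta> \<in> ?K" for \<theta>
    using that M TS compact by (simp add: compact_semimodule_congruence_def)
  note car = compact_semimodule_congruence.carrier_Q[OF loc]
    and eqv = compact_semimodule_congruence.equiv[OF loc]
    and add = compact_semimodule_congruence.add_Q[OF loc]
    and smult = compact_semimodule_congruence.smult_Q[OF loc]
  have sm: "semimodule S M" and TM: "topspace TM = carrier M"
    using M by (auto simp: strongly_continuous_semimodule_def)
  interpret semimodule S M by fact
  have \<phi>: "\<phi> \<theta> \<theta>' (\<theta>' `` {x}) = \<theta> `` {x}" if "(\<theta>, \<theta>') \<in> r" for \<theta> \<theta>' x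
    using that refines_equiv_class_eq2[of \<theta>' \<theta> "carrier M" x] eqv by (simp add: \<phi>_def r_def)
  have dir: "directed_poset ?K r"
    unfolding directed_poset_def
  proof (intro conjI ballI)
    show "?K \<noteq> {}"
      using open_congruence_total[OF sm TM] by blast
    show "partial_order_on ?K r"
      by (auto simp: order_on_defs refl_on_def trans_def antisym_def r_def)
    show "\<exists>k\<in>?K. (\<theta>, k) \<in> r \<and> (\<theta>', k) \<in> r" if "\<theta> \<in> ?K" "\<theta>' \<in> ?K" for \<theta> \<theta>'
      using that open_congruence_Int by (intro bexI[of _ "\<theta> \<inter> \<theta>'"]) (auto simp: r_def)
  qed
  have sys: "inverse_system ?K r ?A \<phi>"
    unfolding inverse_system_def
  proof (intro conjI allI impI ballI dir)
    show "\<phi> \<theta> \<theta>' \<in> ?A \<theta>' \<rightarrow> ?A \<theta>" if "(\<theta>, \<theta>') \<in> r" for \<theta> \<theta>'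
      using \<phi>[OF that] that by (auto simp: car r_def)
    show "\<phi> \<theta> \<theta> C = C" if "\<theta> \<in> ?K" "C \<in> ?A \<theta>" for \<theta> C
      using \<phi>[of \<theta> \<theta>] that by (auto simp: car r_def)
    show "\<phi> \<theta>1 \<theta>2 (\<phi> \<theta>2 \<theta>3 C) = \<phi> \<theta>1 \<theta>3 C"
      if "(\<theta>1, \<theta>2) \<in> r" "(\<theta>2, \<theta>3) \<in> r" "C \<in> ?A \<theta>3" for \<theta>1 \<theta>2 \<theta>3 C
    proof -
      have "(\<theta>1, \<theta>3) \<in> r" using that by (auto simp: r_def)
      moreover have "\<theta>3 \<in> ?K" using that by (simp add: r_def)
      ultimately show ?thesis
        using that \<phi> by (auto simp: car)
    qed
  qed
  have \<phi>_hom: "\<phi> \<theta> \<theta>' \<in> semimodule_hom S (?N \<theta>') (?N \<theta>)" if "(\<theta>, \<theta>') \<in> r" for \<theta> \<theta>'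
  proof -
    have K: "\<theta> \<in> ?K" "\<theta>' \<in> ?K" using that by (auto simp: r_def)
    have "\<zero>\<^bsub>?N \<theta>\<^esub> = \<theta> `` {\<zero>\<^bsub>M\<^esub>}" "\<zero>\<^bsub>?N \<theta>'\<^esub> = \<theta>' `` {\<zero>\<^bsub>M\<^esub>}"
      using compact_semimodule_congruence.zero_Q[OF loc] K by auto
    then show ?thesis
      using K \<phi>[OF that] by (auto simp: semimodule_hom_def car add smult smult_closed)
  qed
  let ?T = "subtopology (product_topology (\<lambda>\<theta>. discrete_topology (?A \<theta>)) ?K) (threads ?K r ?A \<phi>)"
  let ?h = "\<lambda>x. \<lambda>\<theta>\<in>?K. \<theta> `` {x}"
  have topT: "topspace ?T = threads ?K r ?A \<phi>"
    by (auto simp: threads_def)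
  have h: "?h x \<in> threads ?K r ?A \<phi>" if "x \<in> carrier M" for x
  proof -
    have "(\<theta>, \<theta>') \<in> r \<Longrightarrow> \<phi> \<theta> \<theta>' (?h x \<theta>') = ?h x \<theta>" for \<theta> \<theta>'
      using \<phi>[of \<theta> \<theta>' x] by (auto simp: r_def)
    then show ?thesis
      unfolding threads_def using that by (auto simp: car)
  qed
  have "homeomorphic_map TM ?T ?h"
  proof (rule continuous_imp_homeomorphic_map[OF _ compact])
    show "continuous_map TM ?T ?h"
      using compact_semimodule_congruence.continuous_class[OF loc] h
      by (auto simp: continuous_map_in_subtopology continuous_map_componentwise TM)
    show "Hausdorff_space ?T"
      by (simp add: Hausdorff_space_subtopology Hausdorff_space_product_topology)
    show "inj_on ?h (topspace TM)"
    proof (rule inj_onI, rule ccontr)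
      fix x y assume xy: "x \<in> topspace TM" "y \<in> topspace TM" "?h x = ?h y" "x \<noteq> y"
      then obtain \<theta> where \<theta>: "\<theta> \<in> ?K" "(x, y) \<notin> \<theta>"
        using sep[of x y] unfolding TM by blast
      then have "\<theta> `` {x} = \<theta> `` {y}"
        using fun_cong[OF xy(3), of \<theta>] by simp
      then show False
        using \<theta> xy(1,2) eq_equiv_class_iff[OF eqv[OF \<theta>(1)]] TM by auto
    qed
    show "?h ` topspace TM = topspace ?T"
      unfolding topT
    proof (intro subset_antisym subsetI)
      fix t assume "t \<in> threads ?K r ?A \<phi>"
      then have tA: "\<And>\<theta>. \<theta> \<in> ?K \<Longrightarrow> t \<theta> \<in> ?A \<theta>" and ext: "t \<in> extensional ?K"
        and comp: "\<And>\<theta> \<theta>'. (\<theta>, \<theta>') \<in> r \<Longrightarrow> \<phi> \<theta> \<theta>' (t \<theta>') = t \<theta>"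
        by (auto simp: threads_def PiE_iff)
      \<comment> \<open>Compatibility of a thread says that its classes shrink as the congruence
        gets finer.\<close>
      have mono: "t \<theta>' \<subseteq> t \<theta>" if "(\<theta>, \<theta>') \<in> r" for \<theta> \<theta>'
      proof -
        have K: "\<theta> \<in> ?K" "\<theta>' \<in> ?K" "\<theta>' \<subseteq> \<theta>" using that by (auto simp: r_def)
        obtain x where x: "t \<theta>' = \<theta>' `` {x}"
          using tA[OF K(2)] car[OF K(2)] by auto
        then show ?thesis
          using comp[OF that] \<phi>[OF that] K by auto
      qed
      have closed: "closedin TM (t \<theta>)" if \<theta>: "\<theta> \<in> ?K" for \<theta>
      proof -
        have "closedin TM {x \<in> topspace TM. \<theta> `` {x} \<in> {t \<theta>}}"
          by (rule clopen_fibre_discrete(2)[OF compact_semimodule_congruence.continuous_class[OF loc[OF \<theta>]]])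
        moreover have "{x \<in> topspace TM. \<theta> `` {x} \<in> {t \<theta>}} = t \<theta>"
          using tA[OF \<theta>] equiv_class_eq_iff[OF eqv[OF \<theta>]] equiv_type[OF eqv[OF \<theta>]]
          by (auto simp: car[OF \<theta>] TM)
        ultimately show ?thesis by simp
      qed
      \<comment> \<open>In \<open>r\<close> an upper bound is a finer congruence, so by
        \<open>mono\<close> its nonempty class lies in all classes of a finite subfamily.\<close>
      have below: "\<exists>\<theta>\<in>?K. \<forall>\<theta>'\<in>F. (\<theta>', \<theta>) \<in> r" if "finite F" "F \<subseteq> ?K" for F
        using that
      proof (induction F rule: finite_induct)
        case empty
        then show ?case using open_congruence_total[OF sm TM] by auto
      next
        case (insert \<theta> F)
        then obtain \<theta>' where "\<theta>' \<in> ?K" "\<forall>\<theta>''\<in>F. (\<theta>'', \<theta>') \<in> r" by auto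
        then show ?case
          using insert.prems open_congruence_Int
          by (intro bexI[of _ "\<theta> \<inter> \<theta>'"]) (auto simp: r_def)
      qed
      have "\<Inter> (t ` ?K) \<noteq> {}"
      proof -
        have "\<Inter> \<F> \<noteq> {}" if "finite \<F>" "\<F> \<subseteq> t ` ?K" for \<F>
        proof -
          obtain F where F: "finite F" "F \<subseteq> ?K" "\<F> = t ` F"
            using finite_subset_image[OF \<open>finite \<F>\<close> \<open>\<F> \<subseteq> t ` ?K\<close>] by blast
          obtain \<theta> where \<theta>: "\<theta> \<in> ?K" "\<forall>\<theta>'\<in>F. (\<theta>', \<theta>) \<in> r"
            using below[OF F(1,2)] by (elim bexE)
          obtain z where "z \<in> carrier M" "t \<theta> = \<theta> `` {z}"
            using tA[OF \<theta>(1)] by (auto simp: car[OF \<theta>(1)])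
          then have "z \<in> t \<theta>"
            using equiv_class_self[OF eqv[OF \<theta>(1)]] by simp
          moreover have "t \<theta> \<subseteq> \<Inter> \<F>"
            using mono \<theta>(2) by (auto simp: F(3))
          ultimately show ?thesis
            by auto
        qed
        then show ?thesis
          using compact[unfolded compact_space_fip, rule_format, of "t ` ?K"] closed
          by (auto simp del: Inter_iff)
      qed
      then obtain x where x: "\<And>\<theta>. \<theta> \<in> ?K \<Longrightarrow> x \<in> t \<theta>" by blast
      \<comment> \<open>The class that \<open>t\<close> assigns to the total congruence is the whole
        carrier, which places \<open>x\<close> in \<open>carrier M\<close>.\<close>
      have tot: "carrier M \<times> carrier M \<in> ?K"
        using open_congruence_total[OF sm TM] by simp
      have "x \<in> carrier M"
        using x[OF tot] tA[OF tot] by (auto simp: car[OF tot])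
      moreover have "t \<theta> = \<theta> `` {x}" if \<theta>: "\<theta> \<in> ?K" for \<theta>
      proof -
        obtain y where "y \<in> carrier M" "t \<theta> = \<theta> `` {y}"
          using tA[OF \<theta>] by (auto simp: car[OF \<theta>])
        then show ?thesis
          using x[OF \<theta>] equiv_class_eq[OF eqv[OF \<theta>], of y x] by auto
      qed
      then have "t = ?h x"
        using ext by (auto simp: fun_eq_iff extensional_def)
      ultimately show "t \<in> ?h ` topspace TM"
        using TM by blast
    qed (use h TM in auto)
  qed
  then have "limit_of_finite_semimodules S TS M TM ?K r ?N \<phi> ?p"
    unfolding limit_of_finite_semimodules_def limit_cone_def
  proof (intro conjI ballI allI impI sys \<phi>_hom)
    fix \<theta> assume \<theta>: "\<theta> \<in> ?K"
    show "finite (?A \<theta>)" "strongly_continuous_semimodule S TS (?N \<theta>) (discrete_topology (?A \<theta>))"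
      "?p \<theta> \<in> semimodule_hom S M (?N \<theta>)"
      using compact_semimodule_congruence.finite_Q[OF loc[OF \<theta>]]
        compact_semimodule_congruence.strongly_continuous_Q[OF loc[OF \<theta>]]
        compact_semimodule_congruence.class_hom[OF loc[OF \<theta>]] by simp_all
  qed
  \<comment> \<open>The elements of the quotients are sets; \<open>profinite_semimoduleI\<close>
    trades these quotients for semimodules on naturals.\<close>
  then show ?thesis
    by (rule profinite_semimoduleI[OF M TS])
qed

section \<open>Profinite semirings as topological semirings\<close>

lemma continuous_map_discrete_binop:
  assumes "continuous_map Z (discrete_topology U) f" and "continuous_map Z (discrete_topology V) g"
    and "\<And>u v. u \<in> U \<Longrightarrow> v \<in> V \<Longrightarrow> h u v \<in> W"
  shows "continuous_map Z (discrete_topology W) (\<lambda>z. h (f z) (g z))"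
proof -
  have "continuous_map (prod_topology (discrete_topology U) (discrete_topology V))
      (discrete_topology W) (\<lambda>(u, v). h u v)"
    using assms(3) by (auto simp flip: prod_topology_discrete_topology)
  then show ?thesis
    using continuous_map_compose[OF continuous_map_pairedI[OF assms(1,2)]] by (fastforce simp: o_def)
qed

text \<open>The treatment of measures draws on \<open>S\<close> only through these consequences of
  profiniteness. The target of \<open>p\<close> is a \<open>nat ring\<close> because the stages in
  \<open>profinite_semiring\<close> live on naturals.\<close>

locale profinite_semiring_space = semiring S for S :: "'s ring" (structure) +
  fixes TS :: "'s topology"
  assumes topspace_TS: "topspace TS = carrier S"
    and compact_TS: "compact_space TS" and Hausdorff_TS: "Hausdorff_space TS"
    and continuous_add: "continuous_map (prod_topology TS TS) TS (\<lambda>(x, y). x \<oplus> y)"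
    and continuous_mult: "continuous_map (prod_topology TS TS) TS (\<lambda>(x, y). x \<otimes> y)"
    and separated: "x \<in> carrier S \<Longrightarrow> y \<in> carrier S \<Longrightarrow> x \<noteq> y \<Longrightarrow>
      \<exists>(N :: nat ring) p. p \<in> semiring_hom S N \<and>
        continuous_map TS (discrete_topology (carrier N)) p \<and> p x \<noteq> p y"

text \<open>Continuity of the operations is tested at each stage, where the projection turns them
  into operations on a discrete set.\<close>

lemma profinite_semiring_imp_space:
  assumes "profinite_semiring S TS"
  shows "profinite_semiring_space S TS"
proof -
  obtain I :: "('a \<times> 'a) set set" and r and N :: "('a \<times> 'a) set \<Rightarrow> nat ring" and \<phi> p
    where "limit_of_finite_semirings S TS I r N \<phi> p"
    using assms unfolding profinite_semiring_def by blast
  then have S: "semiring S" and TS: "topspace TS = carrier S"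
    and N: "\<And>i. i \<in> I \<Longrightarrow> semiring (N i)" and fin: "\<And>i. i \<in> I \<Longrightarrow> finite (carrier (N i))"
    and sys: "inverse_system I r (\<lambda>i. carrier (N i)) \<phi>"
    and p: "\<And>i. i \<in> I \<Longrightarrow> p i \<in> semiring_hom S (N i)"
    and lim: "limit_cone TS I r (\<lambda>i. carrier (N i)) \<phi> p"
    by (auto simp: limit_of_finite_semirings_def)
  interpret semiring S by fact
  note pc = limit_cone_continuous_proj[OF lim]
  have pfst: "continuous_map (prod_topology TS TS) (discrete_topology (carrier (N i))) (\<lambda>z. p i (fst z))"
    and psnd: "continuous_map (prod_topology TS TS) (discrete_topology (carrier (N i))) (\<lambda>z. p i (snd z))"
    if "i \<in> I" for i
    using continuous_map_compose[OF continuous_map_fst pc[OF that]]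
      continuous_map_compose[OF continuous_map_snd pc[OF that]] by (auto simp: o_def)
  have add: "p i (x \<oplus>\<^bsub>S\<^esub> y) = p i x \<oplus>\<^bsub>N i\<^esub> p i y"
    and mult: "p i (x \<otimes>\<^bsub>S\<^esub> y) = p i x \<otimes>\<^bsub>N i\<^esub> p i y"
    if "i \<in> I" "x \<in> carrier S" "y \<in> carrier S" for i x y
    using p[OF that(1)] that by (auto simp: semiring_hom_def ring_hom_def)
  show ?thesis
  proof
    show "topspace TS = carrier S" by fact
    show "compact_space TS" by (rule limit_cone_compact[OF sys lim fin])
    show "Hausdorff_space TS" by (rule limit_cone_Hausdorff[OF lim])
    show "continuous_map (prod_topology TS TS) TS (\<lambda>(x, y). x \<oplus>\<^bsub>S\<^esub> y)"
    proof (rule limit_cone_continuous_mapI[OF lim])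
      fix i assume i: "i \<in> I"
      interpret Ni: semiring "N i" by (rule N[OF i])
      have "continuous_map (prod_topology TS TS) (discrete_topology (carrier (N i)))
          (\<lambda>z. p i (fst z) \<oplus>\<^bsub>N i\<^esub> p i (snd z))"
        by (rule continuous_map_discrete_binop[OF pfst[OF i] psnd[OF i]]) simp
      then show "continuous_map (prod_topology TS TS) (discrete_topology (carrier (N i)))
          (\<lambda>z. p i (case z of (x, y) \<Rightarrow> x \<oplus>\<^bsub>S\<^esub> y))"
        by (rule continuous_map_eq) (auto simp: TS add[OF i])
    qed (auto simp: TS)
    show "continuous_map (prod_topology TS TS) TS (\<lambda>(x, y). x \<otimes>\<^bsub>S\<^esub> y)"
    proof (rule limit_cone_continuous_mapI[OF lim])
      fix i assume i: "i \<in> I"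
      interpret Ni: semiring "N i" by (rule N[OF i])
      have "continuous_map (prod_topology TS TS) (discrete_topology (carrier (N i)))
          (\<lambda>z. p i (fst z) \<otimes>\<^bsub>N i\<^esub> p i (snd z))"
        by (rule continuous_map_discrete_binop[OF pfst[OF i] psnd[OF i]]) simp
      then show "continuous_map (prod_topology TS TS) (discrete_topology (carrier (N i)))
          (\<lambda>z. p i (case z of (x, y) \<Rightarrow> x \<otimes>\<^bsub>S\<^esub> y))"
        by (rule continuous_map_eq) (auto simp: TS mult[OF i])
    qed (auto simp: TS)
    show "\<exists>(N :: nat ring) p. p \<in> semiring_hom S N \<and>
        continuous_map TS (discrete_topology (carrier N)) p \<and> p x \<noteq> p y"
      if xy: "x \<in> carrier S" "y \<in> carrier S" "x \<noteq> y" for x y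
    proof -
      obtain i where "i \<in> I" "p i x \<noteq> p i y"
        using limit_cone_eqI[OF lim, of x y] xy unfolding TS by blast
      then show ?thesis
        using p pc by blast
    qed
  qed
qed

section \<open>The semimodule of measures\<close>

lemma clopens_simps [simp]:
  "{} \<in> clopens X" "topspace X \<in> clopens X"
  "a \<in> clopens X \<Longrightarrow> b \<in> clopens X \<Longrightarrow> a \<inter> b \<in> clopens X"
  "a \<in> clopens X \<Longrightarrow> b \<in> clopens X \<Longrightarrow> a \<union> b \<in> clopens X"
  "a \<in> clopens X \<Longrightarrow> b \<in> clopens X \<Longrightarrow> a - b \<in> clopens X"
  by (auto simp: clopens_def)

lemma clopens_subset: "b \<in> clopens X \<Longrightarrow> b \<subseteq> topspace X"
  by (auto simp: clopens_def dest: openin_subset)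

lemma measure_semimodule_simps [simp]:
  "carrier (measure_semimodule X S) = measures_on X S"
  "\<zero>\<^bsub>measure_semimodule X S\<^esub> = (\<lambda>b\<in>clopens X. \<zero>\<^bsub>S\<^esub>)"
  "\<mu> \<oplus>\<^bsub>measure_semimodule X S\<^esub> \<nu> = (\<lambda>b\<in>clopens X. \<mu> b \<oplus>\<^bsub>S\<^esub> \<nu> b)"
  "s \<odot>\<^bsub>measure_semimodule X S\<^esub> \<mu> = (\<lambda>b\<in>clopens X. s \<otimes>\<^bsub>S\<^esub> \<mu> b)"
  by (simp_all add: measure_semimodule_def)

lemma measures_onD:
  assumes "\<mu> \<in> measures_on X S"
  shows "b \<in> clopens X \<Longrightarrow> \<mu> b \<in> carrier S" and "\<mu> {} = \<zero>\<^bsub>S\<^esub>"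
    and "a \<in> clopens X \<Longrightarrow> b \<in> clopens X \<Longrightarrow> a \<inter> b = {} \<Longrightarrow> \<mu> (a \<union> b) = \<mu> a \<oplus>\<^bsub>S\<^esub> \<mu> b"
    and "\<mu> \<in> extensional (clopens X)"
  using assms by (auto simp: measures_on_def PiE_iff)

lemma measures_on_eqI:
  assumes "\<mu> \<in> measures_on X S" "\<nu> \<in> measures_on X S" "\<And>b. b \<in> clopens X \<Longrightarrow> \<mu> b = \<nu> b"
  shows "\<mu> = \<nu>"
  using extensionalityI[OF measures_onD(4)[OF assms(1)] measures_onD(4)[OF assms(2)]] assms(3)
  by blast

context profinite_semiring_space
begin

lemma measures_on_zero: "(\<lambda>b\<in>clopens X. \<zero>) \<in> measures_on X S"
  by (auto simp: measures_on_def)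

lemma measures_on_add:
  assumes "\<mu> \<in> measures_on X S" "\<nu> \<in> measures_on X S"
  shows "(\<lambda>b\<in>clopens X. \<mu> b \<oplus> \<nu> b) \<in> measures_on X S"
  using assms unfolding measures_on_def by (auto simp: PiE_iff a_ac)

lemma measures_on_smult:
  assumes "s \<in> carrier S" "\<mu> \<in> measures_on X S"
  shows "(\<lambda>b\<in>clopens X. s \<otimes> \<mu> b) \<in> measures_on X S"
  using assms unfolding measures_on_def by (auto simp: PiE_iff r_distr)

lemma dirac_measures_on: "dirac X S x \<in> measures_on X S"
  by (auto simp: measures_on_def dirac_def)

lemma semimodule_measures: "semimodule S (measure_semimodule X S)"
proof (intro semimodule.intro abelian_monoidI semimodule_axioms.intro semiring_axioms)
qed (auto simp: measures_on_zero measures_on_add measures_on_smult measures_onD a_ac r_distr l_distr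
    m_assoc fun_eq_iff intro: extensional_arb dest: measures_onD(4)[THEN extensional_arb])

section \<open>Topological properties of the space of measures\<close>

lemma topspace_measure_topology: "topspace (measure_topology X S TS) = measures_on X S"
  by (auto simp: measure_topology_def topspace_TS measures_on_def)

lemma continuous_map_measure_eval:
  assumes "b \<in> clopens X"
  shows "continuous_map (measure_topology X S TS) TS (\<lambda>\<mu>. \<mu> b)"
  unfolding measure_topology_def
  by (intro continuous_map_from_subtopology continuous_map_product_projection assms)

lemma continuous_map_into_measuresI:
  assumes "\<And>z. z \<in> topspace Z \<Longrightarrow> f z \<in> measures_on X S"
    and "\<And>b. b \<in> clopens X \<Longrightarrow> continuous_map Z TS (\<lambda>z. f z b)"
  shows "continuous_map Z (measure_topology X S TS) f"
  unfolding measure_topology_def continuous_map_in_subtopology continuous_map_componentwise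
  using assms measures_onD(4)[OF assms(1)] by auto

lemma continuous_map_add:
  assumes "continuous_map Z TS f" "continuous_map Z TS g"
  shows "continuous_map Z TS (\<lambda>z. f z \<oplus> g z)"
  using continuous_map_compose[OF continuous_map_pairedI[OF assms] continuous_add] by (simp add: o_def)

lemma continuous_map_mult:
  assumes "continuous_map Z TS f" "continuous_map Z TS g"
  shows "continuous_map Z TS (\<lambda>z. f z \<otimes> g z)"
  using continuous_map_compose[OF continuous_map_pairedI[OF assms] continuous_mult] by (simp add: o_def)

lemma strongly_continuous_measures:
  "strongly_continuous_semimodule S TS (measure_semimodule X S) (measure_topology X S TS)"
  unfolding strongly_continuous_semimodule_def
proof (intro conjI semimodule_measures)
  let ?T = "measure_topology X S TS"
  show "topspace ?T = carrier (measure_semimodule X S)"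
    by (simp add: topspace_measure_topology)
  note eval = continuous_map_compose[OF _ continuous_map_measure_eval, unfolded o_def]
  show "continuous_map (prod_topology ?T ?T) ?T (\<lambda>(\<mu>, \<nu>). \<mu> \<oplus>\<^bsub>measure_semimodule X S\<^esub> \<nu>)"
    unfolding case_prod_beta
  proof (rule continuous_map_into_measuresI)
    fix b assume "b \<in> clopens X"
    then show "continuous_map (prod_topology ?T ?T) TS (\<lambda>z. (fst z \<oplus>\<^bsub>measure_semimodule X S\<^esub> snd z) b)"
      by (simp add: continuous_map_add eval[OF continuous_map_fst] eval[OF continuous_map_snd])
  qed (auto simp: topspace_measure_topology measures_on_add)
  show "continuous_map (prod_topology TS ?T) ?T (\<lambda>(s, \<mu>). s \<odot>\<^bsub>measure_semimodule X S\<^esub> \<mu>)"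
    unfolding case_prod_beta
  proof (rule continuous_map_into_measuresI)
    fix b assume "b \<in> clopens X"
    then show "continuous_map (prod_topology TS ?T) TS (\<lambda>z. (fst z \<odot>\<^bsub>measure_semimodule X S\<^esub> snd z) b)"
      by (simp add: continuous_map_mult continuous_map_fst eval[OF continuous_map_snd])
  qed (auto simp: topspace_measure_topology topspace_TS measures_on_smult)
qed

text \<open>Measures form a closed subset of a compact power of \<open>TS\<close>: normalization and
  each instance of additivity equate continuous maps into the Hausdorff space
  \<open>TS\<close>.\<close>

lemma compact_space_measures: "compact_space (measure_topology X S TS)"
proof -
  let ?P = "product_topology (\<lambda>b. TS) (clopens X)"
  let ?D = "{(a, b). a \<in> clopens X \<and> b \<in> clopens X \<and> a \<inter> b = {}}"
  define E where "E = (\<lambda>(a, b). {\<mu> \<in> topspace ?P. \<mu> (a \<union> b) = \<mu> a \<oplus> \<mu> b})"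
  define E0 where "E0 = {\<mu> \<in> topspace ?P. \<mu> {} = \<zero>}"
  have proj: "continuous_map ?P TS (\<lambda>\<mu>. \<mu> b)" if "b \<in> clopens X" for b
    by (intro continuous_map_product_projection that)
  have "closedin ?P E0"
    unfolding E0_def by (intro closedin_continuous_maps_eq[OF Hausdorff_TS] proj) (simp_all add: topspace_TS)
  moreover have "closedin ?P (E ab)" if "ab \<in> ?D" for ab
    using that unfolding E_def
    by (auto intro!: closedin_continuous_maps_eq[OF Hausdorff_TS] proj continuous_map_add simp del: topspace_product_topology)
  ultimately have "closedin ?P (\<Inter> (insert E0 (E ` ?D)))"
    by (intro closedin_Inter) auto
  moreover have "\<Inter> (insert E0 (E ` ?D)) = measures_on X S"
    by (auto simp: E0_def E_def measures_on_def topspace_TS)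
  ultimately have "closedin ?P (measures_on X S)"
    by simp
  moreover have "compact_space ?P"
    by (simp add: compact_space_product_topology compact_TS)
  ultimately show ?thesis
    unfolding measure_topology_def by (simp add: closedin_compact_space compact_space_subtopology)
qed

text \<open>This relation is the kernel of \<open>\<mu> \<mapsto> p (\<mu> b)\<close>. It respects
  scalars because \<open>p\<close> is multiplicative: \<open>p (s \<otimes> \<mu> b)\<close> depends
  on \<open>\<mu> b\<close> only through \<open>p (\<mu> b)\<close>.\<close>

lemma open_congruence_measures:
  assumes b: "b \<in> clopens X" and p: "p \<in> semiring_hom S N"
    and cont: "continuous_map TS (discrete_topology (carrier N)) p"
  shows "open_congruence S (measure_semimodule X S) (measure_topology X S TS)
    {(\<mu>, \<nu>). \<mu> \<in> measures_on X S \<and> \<nu> \<in> measures_on X S \<and> p (\<mu> b) = p (\<nu> b)}"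
    (is "open_congruence _ _ ?T ?\<theta>")
proof -
  have add: "p (x \<oplus> y) = p x \<oplus>\<^bsub>N\<^esub> p y" and mult: "p (x \<otimes> y) = p x \<otimes>\<^bsub>N\<^esub> p y"
    if "x \<in> carrier S" "y \<in> carrier S" for x y
    using p that by (auto simp: semiring_hom_def ring_hom_def)
  have "openin ?T (?\<theta> `` {\<mu>})" if "\<mu> \<in> measures_on X S" for \<mu>
  proof -
    have "continuous_map ?T (discrete_topology (carrier N)) (\<lambda>\<mu>. p (\<mu> b))"
      using continuous_map_compose[OF continuous_map_measure_eval[OF b] cont] by (simp add: o_def)
    from clopen_fibre_discrete(1)[OF this, of "{p (\<mu> b)}"]
    have "openin ?T {\<nu> \<in> topspace ?T. p (\<nu> b) \<in> {p (\<mu> b)}}" .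
    moreover have "{\<nu> \<in> topspace ?T. p (\<nu> b) \<in> {p (\<mu> b)}} = ?\<theta> `` {\<mu>}"
      using that by (auto simp: topspace_measure_topology)
    ultimately show ?thesis by simp
  qed
  moreover have "equiv (measures_on X S) ?\<theta>"
    by (auto simp: equiv_def refl_on_def sym_def trans_def)
  ultimately show ?thesis
    using b by (auto simp: open_congruence_def measures_on_add measures_on_smult add mult measures_onD(1))
qed

lemma profinite_measures:
  "profinite_semimodule S TS (measure_semimodule X S) (measure_topology X S TS)"
proof (rule profinite_semimodule_if_separated[OF strongly_continuous_measures topspace_TS compact_space_measures])
  fix \<mu> \<nu> assume *: "\<mu> \<in> carrier (measure_semimodule X S)" "\<nu> \<in> carrier (measure_semimodule X S)" "\<mu> \<noteq> \<nu>"
  then obtain b where b: "b \<in> clopens X" "\<mu> b \<noteq> \<nu> b"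
    using measures_on_eqI[of \<mu> X S \<nu>] by auto
  then obtain N :: "nat ring" and p where "p \<in> semiring_hom S N"
    "continuous_map TS (discrete_topology (carrier N)) p" "p (\<mu> b) \<noteq> p (\<nu> b)"
    using separated[of "\<mu> b" "\<nu> b"] * measures_onD(1) by (metis measure_semimodule_simps(1))
  then show "\<exists>\<theta>. open_congruence S (measure_semimodule X S) (measure_topology X S TS) \<theta> \<and> (\<mu>, \<nu>) \<notin> \<theta>"
    using open_congruence_measures[OF b(1)] by blast
qed

section \<open>Dirac measures and the density of their combinations\<close>

lemma continuous_dirac: "continuous_map X (measure_topology X S TS) (dirac X S)"
proof (rule continuous_map_into_measuresI)
  fix b assume b: "b \<in> clopens X"
  \<comment> \<open>Evaluated at \<open>b\<close>, the Dirac map is the indicator function of a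
    clopen set, hence locally constant.\<close>
  have "continuous_map X (discrete_topology {\<one>, \<zero>}) (\<lambda>x. dirac X S x b)"
  proof (rule continuous_map_discreteI)
    fix u assume "u \<in> {\<one>, \<zero>}"
    \<comment> \<open>If \<open>\<one> = \<zero>\<close>, the indicator is constant and its fibre is
      the whole space; otherwise the fibres are \<open>b\<close> and its complement.\<close>
    then have "{x \<in> topspace X. dirac X S x b = u} \<in> {{}, topspace X, b, topspace X - b}"
      using b clopens_subset[OF b] by (cases "\<one> = \<zero>") (auto simp: dirac_def)
    moreover have "openin X a" if "a \<in> {{}, topspace X, b, topspace X - b}" for a
      using that b by (auto simp: clopens_def openin_diff)
    ultimately show "openin X {x \<in> topspace X. dirac X S x b = u}"
      by blast
  qed (use b in \<open>auto simp: dirac_def\<close>)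
  moreover have "continuous_map (discrete_topology {\<one>, \<zero>}) TS (\<lambda>s. s)"
    by (auto simp: topspace_TS)
  ultimately show "continuous_map X TS (\<lambda>x. dirac X S x b)"
    by (rule continuous_map_compose[unfolded o_def])
qed (rule dirac_measures_on)

text \<open>
  The values prescribed for \<open>\<nu>\<close> on sets that avoid or contain \<open>c\<close> carry the induction on \<open>F\<close>: a new
  set \<open>b\<close> splits \<open>c\<close> into \<open>c \<inter> b\<close> and \<open>c - b\<close>, and the two approximations are added.
\<close>

lemma dirac_span_interpolates:
  assumes zero: "(\<lambda>b\<in>clopens X. \<zero>) \<in> E"
    and add: "\<And>\<mu> \<nu>. \<mu> \<in> E \<Longrightarrow> \<nu> \<in> E \<Longrightarrow> (\<lambda>b\<in>clopens X. \<mu> b \<oplus> \<nu> b) \<in> E"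
    and smult: "\<And>s \<mu>. s \<in> carrier S \<Longrightarrow> \<mu> \<in> E \<Longrightarrow> (\<lambda>b\<in>clopens X. s \<otimes> \<mu> b) \<in> E"
    and dirac: "\<And>x. x \<in> topspace X \<Longrightarrow> dirac X S x \<in> E"
    and \<mu>: "\<mu> \<in> measures_on X S" and "finite F" "F \<subseteq> clopens X" "c \<in> clopens X"
  shows "\<exists>\<nu>\<in>E. (\<forall>b\<in>F. \<nu> b = \<mu> (b \<inter> c)) \<and> (\<forall>d\<in>clopens X. d \<inter> c = {} \<longrightarrow> \<nu> d = \<zero>) \<and>
    (\<forall>d\<in>clopens X. c \<subseteq> d \<longrightarrow> \<nu> d = \<mu> c)"
  using \<open>finite F\<close> \<open>F \<subseteq> clopens X\<close> \<open>c \<in> clopens X\<close>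
proof (induction F arbitrary: c rule: finite_induct)
  case empty
  show ?case
  \<comment> \<open>With \<open>F\<close> empty, the whole mass \<open>\<mu> c\<close> is put at one
    point of \<open>c\<close>. If \<open>c = {}\<close> there is no such point, but then
    \<open>\<mu> c = \<zero>\<close> and the zero measure serves.\<close>
  proof (cases "c = {}")
    case True
    then show ?thesis
      using zero measures_onD(2)[OF \<mu>] by (intro bexI[of _ "\<lambda>b\<in>clopens X. \<zero>"]) auto
  next
    case False
    then obtain x where x: "x \<in> c" by blast
    then have "x \<in> topspace X"
      using clopens_subset empty.prems by blast
    then have "(\<lambda>b\<in>clopens X. \<mu> c \<otimes> dirac X S x b) \<in> E"
      using smult dirac measures_onD(1)[OF \<mu>] empty.prems by blast
    then show ?thesis
      using x measures_onD(1)[OF \<mu>] empty.prems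
      by (intro bexI[of _ "\<lambda>b\<in>clopens X. \<mu> c \<otimes> dirac X S x b"]) (auto simp: dirac_def)
  qed
next
  case (insert b0 F)
  have b0: "b0 \<in> clopens X" and F: "F \<subseteq> clopens X" and c: "c \<in> clopens X"
    using insert.prems by auto
  obtain \<nu>1 where \<nu>1: "\<nu>1 \<in> E" "\<And>b. b \<in> F \<Longrightarrow> \<nu>1 b = \<mu> (b \<inter> (c \<inter> b0))"
    "\<And>d. d \<in> clopens X \<Longrightarrow> d \<inter> (c \<inter> b0) = {} \<Longrightarrow> \<nu>1 d = \<zero>"
    "\<And>d. d \<in> clopens X \<Longrightarrow> c \<inter> b0 \<subseteq> d \<Longrightarrow> \<nu>1 d = \<mu> (c \<inter> b0)"
    using insert.IH[OF F, of "c \<inter> b0"] c b0 by auto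
  obtain \<nu>2 where \<nu>2: "\<nu>2 \<in> E" "\<And>b. b \<in> F \<Longrightarrow> \<nu>2 b = \<mu> (b \<inter> (c - b0))"
    "\<And>d. d \<in> clopens X \<Longrightarrow> d \<inter> (c - b0) = {} \<Longrightarrow> \<nu>2 d = \<zero>"
    "\<And>d. d \<in> clopens X \<Longrightarrow> c - b0 \<subseteq> d \<Longrightarrow> \<nu>2 d = \<mu> (c - b0)"
    using insert.IH[OF F, of "c - b0"] c b0 by auto
  have split: "\<mu> (b \<inter> (c \<inter> b0)) \<oplus> \<mu> (b \<inter> (c - b0)) = \<mu> (b \<inter> c)" if b: "b \<in> clopens X" for b
  proof -
    have "b \<inter> (c \<inter> b0) \<union> b \<inter> (c - b0) = b \<inter> c" by blast
    moreover have "b \<inter> (c \<inter> b0) \<inter> (b \<inter> (c - b0)) = {}" by blast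
    ultimately show ?thesis
      using measures_onD(3)[OF \<mu>, of "b \<inter> (c \<inter> b0)" "b \<inter> (c - b0)"] b c b0 by simp
  qed
  let ?\<nu> = "\<lambda>b\<in>clopens X. \<nu>1 b \<oplus> \<nu>2 b"
  show ?case
  proof (intro bexI[of _ ?\<nu>] conjI ballI impI)
    show "?\<nu> \<in> E" using add \<nu>1(1) \<nu>2(1) .
    show "?\<nu> b = \<mu> (b \<inter> c)" if "b \<in> insert b0 F" for b
    proof (cases "b \<in> F")
      case True
      then show ?thesis using F split[of b] \<nu>1(2) \<nu>2(2) by auto
    next
      case False
      then have b: "b = b0" using that by simp
      \<comment> \<open>Interpolation on \<open>F\<close> says nothing about \<open>b0\<close>. But
        \<open>b0\<close> contains \<open>c \<inter> b0\<close> and misses \<open>c - b0\<close>, so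
        the other two clauses determine both summands.\<close>
      have "\<nu>1 b0 = \<mu> (c \<inter> b0)" "\<nu>2 b0 = \<zero>"
        using \<nu>1(4)[OF b0] \<nu>2(3)[OF b0] by auto
      then show ?thesis
        using b b0 c measures_onD(1)[OF \<mu>] by (simp add: Int_commute)
    qed
    show "?\<nu> d = \<zero>" if "d \<in> clopens X" "d \<inter> c = {}" for d
    proof -
      have "d \<inter> (c \<inter> b0) = {}" "d \<inter> (c - b0) = {}" using that by auto
      then show ?thesis using that \<nu>1(3) \<nu>2(3) by simp
    qed
    show "?\<nu> d = \<mu> c" if "d \<in> clopens X" "c \<subseteq> d" for d
    proof -
      have "c \<inter> b0 \<subseteq> d" "c - b0 \<subseteq> d" "d \<inter> c = c" "d \<inter> (c \<inter> b0) = c \<inter> b0" "d \<inter> (c - b0) = c - b0"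
        using that by auto
      then show ?thesis using that \<nu>1(4) \<nu>2(4) split[of d] by simp
    qed
  qed
qed

text \<open>A basic open set of the product topology constrains finitely many values, and these can
  be interpolated inside \<open>E\<close>. Leaving \<open>E\<close> abstract, merely closed under
  the operations, lets the equalizer of two homomorphisms take its place directly.\<close>

lemma dirac_span_dense:
  assumes E: "E \<subseteq> measures_on X S" and zero: "(\<lambda>b\<in>clopens X. \<zero>) \<in> E"
    and add: "\<And>\<mu> \<nu>. \<mu> \<in> E \<Longrightarrow> \<nu> \<in> E \<Longrightarrow> (\<lambda>b\<in>clopens X. \<mu> b \<oplus> \<nu> b) \<in> E"
    and smult: "\<And>s \<mu>. s \<in> carrier S \<Longrightarrow> \<mu> \<in> E \<Longrightarrow> (\<lambda>b\<in>clopens X. s \<otimes> \<mu> b) \<in> E"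
    and dirac: "\<And>x. x \<in> topspace X \<Longrightarrow> dirac X S x \<in> E"
    and \<mu>: "\<mu> \<in> measures_on X S"
  shows "\<mu> \<in> measure_topology X S TS closure_of E"
  unfolding in_closure_of
proof (intro conjI allI impI)
  show "\<mu> \<in> topspace (measure_topology X S TS)"
    using \<mu> by (simp add: topspace_measure_topology)
  fix U assume "\<mu> \<in> U \<and> openin (measure_topology X S TS) U"
  then obtain V where V: "openin (product_topology (\<lambda>b. TS) (clopens X)) V" "\<mu> \<in> V"
    and U: "U = V \<inter> measures_on X S"
    by (auto simp: measure_topology_def openin_subtopology)
  then obtain W where fin: "finite {b \<in> clopens X. W b \<noteq> topspace TS}"
    and W: "\<mu> \<in> Pi\<^sub>E (clopens X) W" "Pi\<^sub>E (clopens X) W \<subseteq> V"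
    unfolding openin_product_topology_alt by blast
  \<comment> \<open>Interpolation with \<open>c = topspace X\<close>, for which
    \<open>b \<inter> c = b\<close>.\<close>
  have "\<exists>\<nu>\<in>E. (\<forall>b\<in>{b \<in> clopens X. W b \<noteq> topspace TS}. \<nu> b = \<mu> (b \<inter> topspace X)) \<and>
      (\<forall>d\<in>clopens X. d \<inter> topspace X = {} \<longrightarrow> \<nu> d = \<zero>) \<and>
      (\<forall>d\<in>clopens X. topspace X \<subseteq> d \<longrightarrow> \<nu> d = \<mu> (topspace X))"
    by (rule dirac_span_interpolates) (fact zero add smult dirac \<mu> fin | force)+
  then obtain \<nu> where \<nu>: "\<nu> \<in> E"
    "\<And>b. b \<in> clopens X \<Longrightarrow> W b \<noteq> topspace TS \<Longrightarrow> \<nu> b = \<mu> (b \<inter> topspace X)"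
    by (elim bexE conjE) simp
  have \<nu>_meas: "\<nu> \<in> measures_on X S"
    using \<nu>(1) E by auto
  have "\<nu> b \<in> W b" if b: "b \<in> clopens X" for b
  proof (cases "W b = topspace TS")
    case True
    then show ?thesis
      using measures_onD(1)[OF \<nu>_meas b] topspace_TS by simp
  next
    case False
    then show ?thesis
      using \<nu>(2)[OF b] W(1) b clopens_subset[OF b] by (auto simp: Int_absorb2)
  qed
  then have "\<nu> \<in> Pi\<^sub>E (clopens X) W"
    using measures_onD(4)[OF \<nu>_meas] by (simp add: PiE_iff)
  then have "\<nu> \<in> U"
    using W(2) U \<nu>_meas by auto
  then show "\<exists>\<nu>. \<nu> \<in> E \<and> \<nu> \<in> U"
    using \<nu>(1) by auto
qed

text \<open>The equalizer of \<open>g\<close> and \<open>h\<close> is a subsemimodule containing the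
  Dirac measures, hence dense; it is closed because \<open>TY\<close> is Hausdorff.\<close>

lemma measure_hom_unique:
  fixes Y :: "('s, 'y) module"
  assumes Hausdorff: "Hausdorff_space TY"
    and g: "g \<in> semimodule_hom S (measure_semimodule X S) Y" "continuous_map (measure_topology X S TS) TY g"
    and h: "h \<in> semimodule_hom S (measure_semimodule X S) Y" "continuous_map (measure_topology X S TS) TY h"
    and eq: "\<And>x. x \<in> topspace X \<Longrightarrow> g (dirac X S x) = h (dirac X S x)"
    and \<mu>: "\<mu> \<in> measures_on X S"
  shows "g \<mu> = h \<mu>"
proof (rule forall_in_closure_of_eq[OF _ Hausdorff g(2) h(2)])
  let ?E = "{\<mu> \<in> measures_on X S. g \<mu> = h \<mu>}"
  show "\<mu> \<in> measure_topology X S TS closure_of ?E"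
    by (rule dirac_span_dense[OF _ _ _ _ _ \<mu>])
      (use g(1) h(1) eq in \<open>auto simp: semimodule_hom_def measures_on_zero measures_on_add
        measures_on_smult dirac_measures_on\<close>)
qed auto

section \<open>Extension along the Dirac measures\<close>

lemma semimodule_finsum_smult:
  assumes "semimodule S N" "finite A" "f \<in> A \<rightarrow> carrier N" "s \<in> carrier S"
  shows "s \<odot>\<^bsub>N\<^esub> finsum N f A = finsum N (\<lambda>a. s \<odot>\<^bsub>N\<^esub> f a) A"
proof -
  interpret N: semimodule S N by fact
  show ?thesis
    using assms(2,3)
    by (induction A rule: finite_induct)
      (simp_all add: N.smult_r_null N.smult_r_distr N.smult_closed Pi_iff N.M.finsum_insert N.M.finsum_closed assms(4))
qed

lemma continuous_map_finsum:
  assumes N: "strongly_continuous_semimodule S TS N TN" and "finite A"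
    and "\<And>a. a \<in> A \<Longrightarrow> continuous_map Z TN (\<lambda>z. h a z)"
  shows "continuous_map Z TN (\<lambda>z. finsum N (\<lambda>a. h a z) A)"
proof -
  interpret N: semimodule S N using N by (simp add: strongly_continuous_semimodule_def)
  have TN: "topspace TN = carrier N"
    and add: "continuous_map (prod_topology TN TN) TN (\<lambda>(x, y). x \<oplus>\<^bsub>N\<^esub> y)"
    using N by (auto simp: strongly_continuous_semimodule_def)
  show ?thesis
    using assms(2,3)
  proof (induction A rule: finite_induct)
    case empty
    then show ?case by (simp add: TN)
  next
    case (insert a A)
    then have "continuous_map Z TN (\<lambda>z. h a z \<oplus>\<^bsub>N\<^esub> finsum N (\<lambda>a. h a z) A)"
      using continuous_map_compose[OF continuous_map_pairedI add, of Z "h a" "\<lambda>z. finsum N (\<lambda>a. h a z) A"]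
      by (simp add: o_def)
    then show ?case
    proof (rule continuous_map_eq)
      fix z assume "z \<in> topspace Z"
      then have "h b z \<in> carrier N" if "b \<in> insert a A" for b
        using continuous_map_funspace[OF insert.prems[OF that]] TN by auto
      then show "h a z \<oplus>\<^bsub>N\<^esub> finsum N (\<lambda>a. h a z) A = finsum N (\<lambda>a. h a z) (insert a A)"
        using insert.hyps by (simp add: N.M.finsum_insert)
    qed
  qed
qed

text \<open>For finite \<open>N\<close> this is the integral of a simple function, whose fibres
  partition the space. Summing over the whole carrier is harmless: an empty fibre contributes
  \<open>\<mu> {} \<odot> n\<close>, which is zero for a measure.\<close>

definition integral_against :: "'x topology \<Rightarrow> ('s, 'n) module \<Rightarrow> ('x \<Rightarrow> 'n) \<Rightarrow> ('x set \<Rightarrow> 's) \<Rightarrow> 'n" where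
  "integral_against X N f \<mu> = (\<Oplus>\<^bsub>N\<^esub>n\<in>carrier N. \<mu> {x \<in> topspace X. f x = n} \<odot>\<^bsub>N\<^esub> n)"

text \<open>Additivity comes from distributivity of the action over sums of scalars. Continuity
  comes from finitely many evaluations of \<open>\<mu>\<close> at clopen sets, each followed by the
  continuous action on a fixed \<open>n\<close>. A Dirac measure leaves only the summand at
  \<open>n = f x\<close>.\<close>

lemma integral_against:
  assumes N: "strongly_continuous_semimodule S TS N (discrete_topology (carrier N))"
    and fin: "finite (carrier N)"
    and f: "continuous_map X (discrete_topology (carrier N)) f"
  shows "integral_against X N f \<in> semimodule_hom S (measure_semimodule X S) N"
    and "continuous_map (measure_topology X S TS) (discrete_topology (carrier N)) (integral_against X N f)"
    and "x \<in> topspace X \<Longrightarrow> integral_against X N f (dirac X S x) = f x"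
proof -
  have sm: "semimodule S N"
    and smult: "continuous_map (prod_topology TS (discrete_topology (carrier N)))
      (discrete_topology (carrier N)) (\<lambda>(s, x). s \<odot>\<^bsub>N\<^esub> x)"
    using N by (auto simp: strongly_continuous_semimodule_def)
  interpret N: semimodule S N by fact
  let ?D = "discrete_topology (carrier N)"
  let ?b = "\<lambda>n. {x \<in> topspace X. f x = n}"
  have b: "?b n \<in> clopens X" for n
    using clopen_fibre_discrete[OF f, of "{n}"] by (simp add: clopens_def)
  have val: "\<mu> (?b n) \<in> carrier S" if "\<mu> \<in> measures_on X S" for \<mu> n
    using measures_onD(1)[OF that b] .
  show "integral_against X N f \<in> semimodule_hom S (measure_semimodule X S) N"
    unfolding semimodule_hom_def
  proof (intro CollectI conjI ballI Pi_I)
    fix \<mu> assume \<mu>: "\<mu> \<in> carrier (measure_semimodule X S)"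
    show "integral_against X N f \<mu> \<in> carrier N"
      unfolding integral_against_def by (rule N.M.finsum_closed) (use \<mu> val N.smult_closed in auto)
    show "integral_against X N f (\<mu> \<oplus>\<^bsub>measure_semimodule X S\<^esub> \<nu>) =
        integral_against X N f \<mu> \<oplus>\<^bsub>N\<^esub> integral_against X N f \<nu>"
      if "\<nu> \<in> carrier (measure_semimodule X S)" for \<nu>
    proof -
      have \<nu>: "\<nu> \<in> measures_on X S" and \<mu>': "\<mu> \<in> measures_on X S"
        using \<mu> that by simp_all
      have "integral_against X N f (\<mu> \<oplus>\<^bsub>measure_semimodule X S\<^esub> \<nu>) =
          (\<Oplus>\<^bsub>N\<^esub>n\<in>carrier N. \<mu> (?b n) \<odot>\<^bsub>N\<^esub> n \<oplus>\<^bsub>N\<^esub> \<nu> (?b n) \<odot>\<^bsub>N\<^esub> n)"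
        unfolding integral_against_def using val[OF \<mu>'] val[OF \<nu>]
        by (intro N.M.finsum_cong') (simp_all add: b N.smult_closed N.smult_l_distr)
      also have "\<dots> = integral_against X N f \<mu> \<oplus>\<^bsub>N\<^esub> integral_against X N f \<nu>"
        unfolding integral_against_def using val[OF \<mu>'] val[OF \<nu>]
        by (intro N.M.finsum_addf) (simp_all add: N.smult_closed)
      finally show ?thesis .
    qed
    show "integral_against X N f (s \<odot>\<^bsub>measure_semimodule X S\<^esub> \<mu>) = s \<odot>\<^bsub>N\<^esub> integral_against X N f \<mu>"
      if "s \<in> carrier S" for s
      unfolding integral_against_def using \<mu> that
      by (subst semimodule_finsum_smult[OF sm fin])
        (auto simp: b val N.smult_closed N.smult_assoc intro!: N.M.finsum_cong')
  next
    show "integral_against X N f \<zero>\<^bsub>measure_semimodule X S\<^esub> = \<zero>\<^bsub>N\<^esub>"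
      unfolding integral_against_def using b
      by (intro N.M.add.finprod_one_eqI) (simp_all add: N.smult_l_null)
  qed
  show "continuous_map (measure_topology X S TS) ?D (integral_against X N f)"
    unfolding integral_against_def
  proof (rule continuous_map_finsum[OF N fin])
    fix n assume "n \<in> carrier N"
    then have "continuous_map (measure_topology X S TS) ?D (\<lambda>\<mu>. n)"
      by simp
    from continuous_map_compose[OF continuous_map_pairedI[OF continuous_map_measure_eval[OF b] this] smult]
    show "continuous_map (measure_topology X S TS) ?D (\<lambda>\<mu>. \<mu> (?b n) \<odot>\<^bsub>N\<^esub> n)"
      by (simp add: o_def)
  qed
  show "integral_against X N f (dirac X S x) = f x" if x: "x \<in> topspace X"
  proof -
    have fx: "f x \<in> carrier N"
      using continuous_map_funspace[OF f] x by auto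
    have "integral_against X N f (dirac X S x) =
        (\<Oplus>\<^bsub>N\<^esub>n\<in>carrier N. if f x = n then n else \<zero>\<^bsub>N\<^esub>)"
      unfolding integral_against_def
      by (rule N.M.finsum_cong') (use b x in \<open>auto simp: dirac_def N.smult_one N.smult_l_null\<close>)
    also have "\<dots> = f x"
      using N.M.finsum_singleton[OF fx fin, of "\<lambda>n. n"] by simp
    finally show ?thesis .
  qed
qed

text \<open>Homomorphisms matter only on the carrier, while a HOL function is total;
  \<open>extensional\<close> fixes the remaining values, so that uniqueness is equality of
  functions.\<close>

lemma measure_hom_extension:
  fixes Y :: "('s, 'y) module" and f :: "'x \<Rightarrow> 'y"
  assumes Y: "profinite_semimodule S TS Y TY" and f: "continuous_map X TY f"
  shows "\<exists>!g. g \<in> extensional (carrier (measure_semimodule X S)) \<and>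
    g \<in> semimodule_hom S (measure_semimodule X S) Y \<and>
    continuous_map (measure_topology X S TS) TY g \<and>
    (\<forall>x\<in>topspace X. g (dirac X S x) = f x)"
proof -
  let ?M = "measure_semimodule X S" and ?T = "measure_topology X S TS"
  have "strongly_continuous_semimodule S TS Y TY"
    using Y by (simp add: profinite_semimodule_def)
  then have Ysm: "semimodule S Y" and TY: "topspace TY = carrier Y"
    by (auto simp: strongly_continuous_semimodule_def)
  interpret Y: semimodule S Y by fact
  obtain I :: "('y \<times> 'y) set set" and r and N :: "('y \<times> 'y) set \<Rightarrow> ('s, nat) module" and \<phi> p
    where limit: "limit_of_finite_semimodules S TS Y TY I r N \<phi> p"
    using Y unfolding profinite_semimodule_def by blast
  have fin: "finite (carrier (N i))"
    and N: "strongly_continuous_semimodule S TS (N i) (discrete_topology (carrier (N i)))"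
    and p: "p i \<in> semimodule_hom S Y (N i)" if "i \<in> I" for i
    using limit that by (auto simp: limit_of_finite_semimodules_def)
  have sys: "inverse_system I r (\<lambda>i. carrier (N i)) \<phi>"
    and \<phi>: "\<And>i j. (i, j) \<in> r \<Longrightarrow> \<phi> i j \<in> semimodule_hom S (N j) (N i)"
    and lim: "limit_cone TY I r (\<lambda>i. carrier (N i)) \<phi> p"
    using limit by (auto simp: limit_of_finite_semimodules_def)
  have p_add: "p i (x \<oplus>\<^bsub>Y\<^esub> y) = p i x \<oplus>\<^bsub>N i\<^esub> p i y"
    and p_smult: "s \<in> carrier S \<Longrightarrow> p i (s \<odot>\<^bsub>Y\<^esub> x) = s \<odot>\<^bsub>N i\<^esub> p i x"
    and p_zero: "p i \<zero>\<^bsub>Y\<^esub> = \<zero>\<^bsub>N i\<^esub>"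
    if "i \<in> I" "x \<in> carrier Y" "y \<in> carrier Y" for i s x y
    using p[OF that(1)] that by (auto simp: semimodule_hom_def)
  have f_closed: "f x \<in> carrier Y" if "x \<in> topspace X" for x
    using continuous_map_funspace[OF f] that TY by auto
  have pf: "continuous_map X (discrete_topology (carrier (N i))) (\<lambda>x. p i (f x))" if "i \<in> I" for i
    using continuous_map_compose[OF f limit_cone_continuous_proj[OF lim that]] by (simp add: o_def)
  define G where "G i = integral_against X (N i) (\<lambda>x. p i (f x))" for i
  have G_hom: "G i \<in> semimodule_hom S ?M (N i)"
    and G_cont: "continuous_map ?T (discrete_topology (carrier (N i))) (G i)"
    and G_dirac: "\<And>x. x \<in> topspace X \<Longrightarrow> G i (dirac X S x) = p i (f x)" if "i \<in> I" for i
    unfolding G_def using integral_against[OF N[OF that] fin[OF that] pf[OF that]] by auto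
  \<comment> \<open>A direct comparison would regroup the sum at stage \<open>j\<close> along the
    fibres of \<open>\<phi> i j\<close>. Instead, both sides are continuous homomorphisms into a
    discrete space, and they agree on Dirac measures since
    \<open>\<phi> i j (p j y) = p i y\<close>.\<close>
  have G_compat: "\<phi> i j (G j \<mu>) = G i \<mu>" if ij: "(i, j) \<in> r" and \<mu>: "\<mu> \<in> measures_on X S" for i j \<mu>
  proof -
    have I: "i \<in> I" "j \<in> I"
      using inverse_system_Field[OF sys ij] by auto
    show ?thesis
    proof (rule measure_hom_unique[OF _ _ _ G_hom[OF I(1)] G_cont[OF I(1)] _ \<mu>])
      show "(\<lambda>\<mu>. \<phi> i j (G j \<mu>)) \<in> semimodule_hom S ?M (N i)"
        using \<phi>[OF ij] G_hom[OF I(2)] by (auto simp: semimodule_hom_def Pi_iff)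
      have "continuous_map (discrete_topology (carrier (N j))) (discrete_topology (carrier (N i))) (\<phi> i j)"
        using \<phi>[OF ij] by (auto simp: semimodule_hom_def)
      then show "continuous_map ?T (discrete_topology (carrier (N i))) (\<lambda>\<mu>. \<phi> i j (G j \<mu>))"
        by (rule continuous_map_compose[OF G_cont[OF I(2)], unfolded o_def])
      show "\<phi> i j (G j (dirac X S x)) = G i (dirac X S x)" if "x \<in> topspace X" for x
        using limit_coneD(3)[OF lim _ I ij, of "f x"] f_closed[OF that] G_dirac I that TY by simp
    qed simp
  qed
  \<comment> \<open>The stagewise integrals of one measure form a thread, and a point of
    \<open>Y\<close> realizes it.\<close>
  have "\<exists>y. y \<in> carrier Y \<and> (\<forall>i\<in>I. p i y = G i \<mu>)" if \<mu>: "\<mu> \<in> measures_on X S" for \<mu>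
  proof (rule limit_cone_threadE[OF lim, of "\<lambda>i. G i \<mu>"])
    show "G i \<mu> \<in> carrier (N i)" if "i \<in> I" for i
      using G_hom[OF that] \<mu> by (auto simp: semimodule_hom_def)
    show "i \<in> I \<and> j \<in> I \<and> \<phi> i j (G j \<mu>) = G i \<mu>" if "(i, j) \<in> r" for i j
      using inverse_system_Field[OF sys that] G_compat[OF that \<mu>] by blast
  qed (use TY in auto)
  then obtain h where h: "\<And>\<mu>. \<mu> \<in> measures_on X S \<Longrightarrow> h \<mu> \<in> carrier Y"
    and ph: "\<And>\<mu> i. \<mu> \<in> measures_on X S \<Longrightarrow> i \<in> I \<Longrightarrow> p i (h \<mu>) = G i \<mu>"
    by metis
  define g where "g = restrict h (measures_on X S)"
  have g: "g \<mu> \<in> carrier Y" and pg: "\<And>i. i \<in> I \<Longrightarrow> p i (g \<mu>) = G i \<mu>" if "\<mu> \<in> measures_on X S" for \<mu>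
    using h ph that by (auto simp: g_def)
  \<comment> \<open>The projections are jointly injective, so each identity required of
    \<open>g\<close> is checked at the stages, where \<open>G i\<close> satisfies it.\<close>
  note eqI = limit_cone_eqI[OF lim, unfolded TY]
  have "g \<in> semimodule_hom S ?M Y"
    unfolding semimodule_hom_def
  proof (intro CollectI conjI ballI Pi_I)
    fix \<mu> assume \<mu>: "\<mu> \<in> carrier ?M"
    then have \<mu>': "\<mu> \<in> measures_on X S" by simp
    show "g \<mu> \<in> carrier Y" using g \<mu> by simp
    show "g (\<mu> \<oplus>\<^bsub>?M\<^esub> \<nu>) = g \<mu> \<oplus>\<^bsub>Y\<^esub> g \<nu>" if \<nu>: "\<nu> \<in> carrier ?M" for \<nu>
    proof (rule eqI)
      have in_M: "\<mu> \<oplus>\<^bsub>?M\<^esub> \<nu> \<in> measures_on X S" using \<mu> \<nu> measures_on_add by simp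
      then show "g (\<mu> \<oplus>\<^bsub>?M\<^esub> \<nu>) \<in> carrier Y" by (rule g)
      have \<nu>': "\<nu> \<in> measures_on X S" using \<nu> by simp
      show "g \<mu> \<oplus>\<^bsub>Y\<^esub> g \<nu> \<in> carrier Y" using g[OF \<mu>'] g[OF \<nu>'] by simp
      fix i assume i: "i \<in> I"
      show "p i (g (\<mu> \<oplus>\<^bsub>?M\<^esub> \<nu>)) = p i (g \<mu> \<oplus>\<^bsub>Y\<^esub> g \<nu>)"
        unfolding pg[OF in_M i] p_add[OF i g[OF \<mu>'] g[OF \<nu>']] pg[OF \<mu>' i] pg[OF \<nu>' i]
        using G_hom[OF i] \<mu> \<nu> unfolding semimodule_hom_def by blast
    qed
    show "g (s \<odot>\<^bsub>?M\<^esub> \<mu>) = s \<odot>\<^bsub>Y\<^esub> g \<mu>" if s: "s \<in> carrier S" for s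
    proof (rule eqI)
      have in_M: "s \<odot>\<^bsub>?M\<^esub> \<mu> \<in> measures_on X S" using \<mu> s measures_on_smult by simp
      then show "g (s \<odot>\<^bsub>?M\<^esub> \<mu>) \<in> carrier Y" by (rule g)
      show "s \<odot>\<^bsub>Y\<^esub> g \<mu> \<in> carrier Y" using g[OF \<mu>'] s Y.smult_closed by simp
      fix i assume i: "i \<in> I"
      show "p i (g (s \<odot>\<^bsub>?M\<^esub> \<mu>)) = p i (s \<odot>\<^bsub>Y\<^esub> g \<mu>)"
        unfolding pg[OF in_M i] p_smult[OF i g[OF \<mu>'] g[OF \<mu>'] s] pg[OF \<mu>' i]
        using G_hom[OF i] \<mu> s unfolding semimodule_hom_def by blast
    qed
  next
    show "g \<zero>\<^bsub>?M\<^esub> = \<zero>\<^bsub>Y\<^esub>"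
    proof (rule eqI)
      have in_M: "\<zero>\<^bsub>?M\<^esub> \<in> measures_on X S" by (simp add: measures_on_zero)
      then show "g \<zero>\<^bsub>?M\<^esub> \<in> carrier Y" by (rule g)
      fix i assume i: "i \<in> I"
      show "p i (g \<zero>\<^bsub>?M\<^esub>) = p i \<zero>\<^bsub>Y\<^esub>"
        unfolding pg[OF in_M i] p_zero[OF i Y.M.zero_closed Y.M.zero_closed]
        using G_hom[OF i] unfolding semimodule_hom_def by blast
    qed simp
  qed
  moreover have "continuous_map ?T TY g"
  proof (rule limit_cone_continuous_mapI[OF lim])
    show "continuous_map ?T (discrete_topology (carrier (N i))) (\<lambda>\<mu>. p i (g \<mu>))" if "i \<in> I" for i
      by (rule continuous_map_eq[OF G_cont[OF that]]) (simp add: pg that topspace_measure_topology)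
  qed (simp add: g TY topspace_measure_topology)
  moreover have "g (dirac X S x) = f x" if "x \<in> topspace X" for x
    by (rule eqI) (use that in \<open>auto simp: g pg G_dirac dirac_measures_on f_closed\<close>)
  moreover have "g \<in> extensional (carrier ?M)"
    by (simp add: g_def)
  ultimately show ?thesis
  proof (intro ex1I[of _ g] conjI ballI)
    fix g' assume g': "g' \<in> extensional (carrier ?M) \<and> g' \<in> semimodule_hom S ?M Y \<and>
      continuous_map ?T TY g' \<and> (\<forall>x\<in>topspace X. g' (dirac X S x) = f x)"
    assume hyps: "g \<in> semimodule_hom S ?M Y" "continuous_map ?T TY g"
      "\<And>x. x \<in> topspace X \<Longrightarrow> g (dirac X S x) = f x" "g \<in> extensional (carrier ?M)"
    show "g' = g"
    proof (rule extensionalityI[of _ "carrier ?M"])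
      show "g' \<mu> = g \<mu>" if "\<mu> \<in> carrier ?M" for \<mu>
        by (rule measure_hom_unique[OF limit_cone_Hausdorff[OF lim]])
          (use g' hyps that in auto)
    qed (use g' hyps in auto)
  qed
qed

end

theorem theorem3p10:
  fixes S :: "'s ring" and TS :: "'s topology" and X :: "'x topology"
  assumes "profinite_semiring S TS" and "Boolean_space X"
  shows "profinite_semimodule S TS (measure_semimodule X S) (measure_topology X S TS) \<and>
    continuous_map X (measure_topology X S TS) (dirac X S) \<and>
    (\<forall>(Y :: ('s, 'y) module) (TY :: 'y topology) f.
       profinite_semimodule S TS Y TY \<longrightarrow> continuous_map X TY f \<longrightarrow>
       (\<exists>!g. g \<in> extensional (carrier (measure_semimodule X S)) \<and>
          g \<in> semimodule_hom S (measure_semimodule X S) Y \<and>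
          continuous_map (measure_topology X S TS) TY g \<and>
          (\<forall>x\<in>topspace X. g (dirac X S x) = f x)))"
proof -
  interpret profinite_semiring_space S TS
    using assms(1) by (rule profinite_semiring_imp_space)
  show ?thesis
    using profinite_measures continuous_dirac measure_hom_extension by (intro conjI allI impI)
qed

end
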